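(* Let $n$ be a natural number and let $(X_p,\delta_p)_{p\in\mathbb{Z}}$ be a sequence of Banach spaces $X_p$ and operators $\delta_p\in L(X_p,X_{p-1})$ such that $X_p=0$ for $p<0$ and $p\ge n+1$, and $\delta_p=0$ for $p\le 0$ and $p>n$. Suppose that for every $p\in\mathbb{Z}$ the range $R(\delta_{p-1}\delta_p)$ is finite dimensional and $\delta_p$ is a regular operator. Let $\mathcal{X}_p=X_p/R(\delta_{p+1}\delta_{p+2})$ and let $\tilde\delta_p\in L(\mathcal{X}_p,\mathcal{X}_{p-1})$ be the operator induced by $\delta_p$. For each $p\in\mathbb{Z}$ let $\tilde\delta_p'\in L(\mathcal{X}_{p-1},\mathcal{X}_p)$ be any generalized inverse of $\tilde\delta_p$, and let $\delta_p'\in L(X_{p-1},X_p)$ be any extension of $\tilde\delta_p'$ (as described in the context). Then the following statements are equivalent: (i) $(X_p,\delta_p)_{p\in\mathbb{Z}}$ is a regular Fredholm chain. (ii) $\delta_{p+1}\delta_{p+1}'+\delta_p'\delta_p\in L(X_p)$ is a Fredholm operator for every $p\in\mathbb{Z}$.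
   Context: $L(X,Y)$ denotes the bounded linear operators from $X$ to $Y$, and $L(X)=L(X,X)$; $N(\cdot)$ and $R(\cdot)$ denote null space and range. An operator $A\in L(X,Y)$ is regular if there is $B\in L(Y,X)$ with $A=ABA$; such a $B$ is called a generalized inverse of $A$. Fredholm chains: a sequence $(X_p,\delta_p)_{p\in\mathbb{Z}}$ of Banach spaces and operators $\delta_p\in L(X_p,X_{p-1})$, with $X_p=0$ for $p<0$ and $p\ge n+1$ and $\delta_p=0$ for $p\le 0$ and $p>n$ for some natural number $n$, is a Fredholm chain if $N(\delta_p)/(N(\delta_p)\cap R(\delta_{p+1}))$ and $R(\delta_{p+1})/(N(\delta_p)\cap R(\delta_{p+1}))$ are finite dimensional for all $p\in\mathbb{Z}$. A Fredholm chain is regular if the operators $S=\bigoplus_{p=2k}\delta_p\colon\bigoplus_{p=2k}X_p\to\bigoplus_{p=2k+1}X_p$ and $T=\bigoplus_{p=2k+1}\delta_p\colon\bigoplus_{p=2k+1}X_p\to\bigoplus_{p=2k}X_p$ (sums over even, respectively odd, $p$) are regular operators (equivalently, every $\delta_p$ is regular). Induced operators: with $\pi_p\colon X_p\to\mathcal{X}_p$ the quotient map, $\tilde\delta_p$ is determined by $\tilde\delta_p\pi_p=\pi_{p-1}\delta_p$. Under the stated hypotheses each $\tilde\delta_p$ is regular. Extensions: fix for each $p$ a closed subspace $X_p^0\subseteq X_p$ with $X_p=R(\delta_{p+1}\delta_{p+2})\oplus X_p^0$. Then $\pi_p|_{X_p^0}\colon X_p^0\to\mathcal{X}_p$ is an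 isomorphism, by means of which $\tilde\delta_p'$ is viewed as an operator $X_{p-1}^0\to X_p^0$. An extension of $\tilde\delta_p'$ is any $\delta_p'\in L(X_{p-1},X_p)$ with $\delta_p'|_{X_{p-1}^0}=(\pi_p|_{X_p^0})^{-1}\tilde\delta_p'\,\pi_{p-1}|_{X_{p-1}^0}$. *)

theory Defs
  imports "HOL-Analysis.Abstract_Metric_Spaces" "HOL-Algebra.AbelCoset" "Jordan_Normal_Form.VS_Connect"
begin

text \<open>
  The spaces of a chain vary with an integer index, so normed spaces are carrier-based: a module
  record of HOL-Algebra extended by a norm, over the scalar field \<open>class_ring\<close> of a type
  \<open>'k :: real_normed_field\<close>. By the Gelfand-Mazur theorem, the types of that
  class are exactly the real and the complex numbers up to isomorphism. The fields \<open>mult\<close> and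
  \<open>one\<close>, which module records inherit from ring records, play no role.
\<close>

record ('k, 'v) normed = "('k, 'v) module" +
  vnorm :: "'v \<Rightarrow> real"

definition normed_space :: "('k::real_normed_field, 'v) normed \<Rightarrow> bool" where
  "normed_space V \<longleftrightarrow>
     vectorspace class_ring V \<and>
     (\<forall>x\<in>carrier V. 0 \<le> vnorm V x \<and> (vnorm V x = 0 \<longleftrightarrow> x = \<zero>\<^bsub>V\<^esub>)) \<and>
     (\<forall>x\<in>carrier V. \<forall>y\<in>carrier V. vnorm V (x \<oplus>\<^bsub>V\<^esub> y) \<le> vnorm V x + vnorm V y) \<and>
     (\<forall>c. \<forall>x\<in>carrier V. vnorm V (c \<odot>\<^bsub>V\<^esub> x) = norm c * vnorm V x)"

text \<open>\<open>Metric_space\<close> demands nonnegativity and symmetry also off the carrier, hence the case split.\<close>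

definition vdist :: "('k::real_normed_field, 'v) normed \<Rightarrow> 'v \<Rightarrow> 'v \<Rightarrow> real" where
  "vdist V x y = (if x \<in> carrier V \<and> y \<in> carrier V then vnorm V (x \<ominus>\<^bsub>V\<^esub> y) else 0)"

lemma Metric_space_vdist:
  assumes "normed_space V"
  shows "Metric_space (carrier V) (vdist V)"
proof -
  interpret V: vectorspace class_ring V
    using assms by (simp add: normed_space_def)
  have tri: "vnorm V (x \<oplus>\<^bsub>V\<^esub> y) \<le> vnorm V x + vnorm V y" if "x \<in> carrier V" "y \<in> carrier V" for x y
    using assms that by (simp add: normed_space_def)
  have pos: "0 \<le> vnorm V x" "vnorm V x = 0 \<longleftrightarrow> x = \<zero>\<^bsub>V\<^esub>" if "x \<in> carrier V" for x
    using assms that by (auto simp: normed_space_def)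
  have neg: "vnorm V (\<ominus>\<^bsub>V\<^esub> x) = vnorm V x" if "x \<in> carrier V" for x
  proof -
    have "\<ominus>\<^bsub>V\<^esub> x = (- 1) \<odot>\<^bsub>V\<^esub> x"
      using V.smult_l_minus[of 1 x] V.smult_one[of x] that by (simp add: class_ring_simps)
    moreover have "vnorm V ((- 1) \<odot>\<^bsub>V\<^esub> x) = vnorm V x"
      using assms that by (simp add: normed_space_def)
    ultimately show ?thesis by simp
  qed
  show ?thesis
  proof
    fix x y show "0 \<le> vdist V x y"
      by (simp add: vdist_def pos)
  next
    fix x y show "vdist V x y = vdist V y x"
      using neg[of "x \<ominus>\<^bsub>V\<^esub> y"] by (auto simp: vdist_def V.minus_eq V.minus_add V.a_comm)
  next
    fix x y assume "x \<in> carrier V" "y \<in> carrier V"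
    then show "vdist V x y = 0 \<longleftrightarrow> x = y"
      by (simp add: vdist_def pos V.minus_eq) (metis V.a_inv_closed V.minus_equality V.minus_minus V.r_neg)
  next
    fix x y z assume *: "x \<in> carrier V" "y \<in> carrier V" "z \<in> carrier V"
    have "x \<ominus>\<^bsub>V\<^esub> z = (x \<ominus>\<^bsub>V\<^esub> y) \<oplus>\<^bsub>V\<^esub> (y \<ominus>\<^bsub>V\<^esub> z)"
      using * by (simp add: V.minus_eq V.a_assoc V.r_neg1)
    then show "vdist V x z \<le> vdist V x y + vdist V y z"
      using * tri[of "x \<ominus>\<^bsub>V\<^esub> y" "y \<ominus>\<^bsub>V\<^esub> z"] by (simp add: vdist_def)
  qed
qed

definition banach_space :: "('k::real_normed_field, 'v) normed \<Rightarrow> bool" where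
  "banach_space V \<longleftrightarrow> normed_space V \<and> Metric_space.mcomplete (carrier V) (vdist V)"

definition closed_subspace :: "('k::real_normed_field, 'v) normed \<Rightarrow> 'v set \<Rightarrow> bool" where
  "closed_subspace V W \<longleftrightarrow>
     VectorSpace.subspace class_ring W V \<and>
     closedin (Metric_space.mtopology (carrier V) (vdist V)) W"

abbreviation findim :: "('k::real_normed_field, 'v) normed \<Rightarrow> bool" where
  "findim V \<equiv> vectorspace.fin_dim class_ring V"

abbreviation restr :: "('k, 'v) normed \<Rightarrow> 'v set \<Rightarrow> ('k, 'v) normed" where
  "restr V W \<equiv> V\<lparr>carrier := W\<rparr>"

text \<open>Operators are total functions, of which only the values on the carrier matter.\<close>

definition bounded_ops ::
  "('k::real_normed_field, 'v) normed \<Rightarrow> ('k, 'w) normed \<Rightarrow> ('v \<Rightarrow> 'w) set" where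
  "bounded_ops X Y =
     {A. A \<in> LinearCombinations.module_hom class_ring X Y \<and>
         (\<exists>C. \<forall>x\<in>carrier X. vnorm Y (A x) \<le> C * vnorm X x)}"

definition generalized_inverse ::
  "('k::real_normed_field, 'v) normed \<Rightarrow> ('k, 'w) normed \<Rightarrow> ('v \<Rightarrow> 'w) \<Rightarrow> ('w \<Rightarrow> 'v) \<Rightarrow> bool" where
  "generalized_inverse X Y A B \<longleftrightarrow>
     B \<in> bounded_ops Y X \<and> (\<forall>x\<in>carrier X. A (B (A x)) = A x)"

definition regular_op ::
  "('k::real_normed_field, 'v) normed \<Rightarrow> ('k, 'w) normed \<Rightarrow> ('v \<Rightarrow> 'w) \<Rightarrow> bool" where
  "regular_op X Y A \<longleftrightarrow> A \<in> bounded_ops X Y \<and> (\<exists>B. generalized_inverse X Y A B)"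

text \<open>
  Elements of the quotient by a subspace \<open>W\<close> are the cosets of \<open>W\<close>. Scalar multiplication
  adds \<open>W\<close> once more so that \<open>0\<close> times a coset is \<open>W\<close> and not \<open>{0}\<close>. \<open>vnorm\<close> is the quotient
  norm; it is only a seminorm if \<open>W\<close> is not closed.
\<close>

definition quotient_space :: "('k::real_normed_field, 'v) normed \<Rightarrow> 'v set \<Rightarrow> ('k, 'v set) normed" where
  "quotient_space V W =
     \<lparr>carrier = a_rcosets\<^bsub>V\<^esub> W,
      mult = (\<lambda>_ _. W), one = W,
      zero = W,
      add = (\<lambda>A B. A <+>\<^bsub>V\<^esub> B),
      smult = (\<lambda>c A. \<Union>a\<in>A. W +>\<^bsub>V\<^esub> (c \<odot>\<^bsub>V\<^esub> a)),
      vnorm = (\<lambda>A. INF a\<in>A. vnorm V a)\<rparr>"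

definition coset_map :: "('k::real_normed_field, 'v) normed \<Rightarrow> 'v set \<Rightarrow> 'v \<Rightarrow> 'v set" where
  "coset_map V W x = W +>\<^bsub>V\<^esub> x"

text \<open>
  The operator from a quotient of the domain of \<open>f\<close> to the quotient of \<open>Y\<close> by \<open>W\<close> induced by \<open>f\<close>:
  when it is well defined, all members of the union over a coset \<open>A\<close> coincide.
\<close>

definition induced_op ::
  "('k::real_normed_field, 'w) normed \<Rightarrow> 'w set \<Rightarrow> ('v \<Rightarrow> 'w) \<Rightarrow> 'v set \<Rightarrow> 'w set" where
  "induced_op Y W f A = (\<Union>a\<in>A. coset_map Y W (f a))"

lemma abelian_subgroup_subspace:
  fixes V :: "('k::real_normed_field, 'v) normed"
  assumes "VectorSpace.subspace class_ring W V"
  shows "abelian_subgroup W V"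
proof -
  interpret V: vectorspace class_ring V using assms by (simp add: VectorSpace.subspace_def)
  interpret W: submodule class_ring W V using assms by (simp add: VectorSpace.subspace_def)
  have "additive_subgroup W V"
  proof (rule additive_subgroup.intro, rule V.add.subgroupI)
    fix w assume w: "w \<in> W"
    then have "w \<in> carrier V" using W.subset by auto
    then have "(- 1) \<odot>\<^bsub>V\<^esub> w = \<ominus>\<^bsub>V\<^esub> w"
      using V.smult_l_minus[of 1 w] V.smult_one[of w] by (simp add: class_ring_simps)
    moreover have "(- 1) \<odot>\<^bsub>V\<^esub> w \<in> W" using w by simp
    ultimately show "\<ominus>\<^bsub>V\<^esub> w \<in> W" by simp
  next
    show "W \<noteq> {}" using W.zero_closed by blast
  qed (use W.subset in auto)
  then show ?thesis
    by (rule abelian_subgroupI3[OF _ V.abelian_group_axioms])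
qed

lemma coset_map_add_subspace:
  fixes V :: "('k::real_normed_field, 'v) normed"
  assumes "VectorSpace.subspace class_ring W V" "w \<in> W" "x \<in> carrier V"
  shows "coset_map V W (w \<oplus>\<^bsub>V\<^esub> x) = coset_map V W x"
proof -
  interpret V: vectorspace class_ring V using assms by (simp add: VectorSpace.subspace_def)
  interpret S: abelian_subgroup W V by (rule abelian_subgroup_subspace) fact
  have "w \<in> carrier V" using S.a_subset assms(2) by auto
  then show ?thesis
    using abelian_group.a_coset_add_assoc[OF V.abelian_group_axioms, of W w x] S.a_rcos_const[OF assms(2)] S.a_subset assms(3)
    by (simp add: coset_map_def)
qed

lemma quotient_space_operations:
  fixes V :: "('k::real_normed_field, 'v) normed"
  assumes "VectorSpace.subspace class_ring W V"
  shows "\<And>x y. x \<in> carrier V \<Longrightarrow> y \<in> carrier V \<Longrightarrow>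
      coset_map V W (x \<oplus>\<^bsub>V\<^esub> y) = coset_map V W x \<oplus>\<^bsub>quotient_space V W\<^esub> coset_map V W y"
    and "\<And>c x. x \<in> carrier V \<Longrightarrow>
      coset_map V W (c \<odot>\<^bsub>V\<^esub> x) = c \<odot>\<^bsub>quotient_space V W\<^esub> coset_map V W x"
proof -
  interpret V: vectorspace class_ring V using assms by (simp add: VectorSpace.subspace_def)
  interpret W: submodule class_ring W V using assms by (simp add: VectorSpace.subspace_def)
  interpret S: abelian_subgroup W V by (rule abelian_subgroup_subspace) fact
  show "coset_map V W (x \<oplus>\<^bsub>V\<^esub> y) = coset_map V W x \<oplus>\<^bsub>quotient_space V W\<^esub> coset_map V W y"
    if "x \<in> carrier V" "y \<in> carrier V" for x y
    using S.a_rcos_sum[of x y] that by (simp add: quotient_space_def coset_map_def)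
  show "coset_map V W (c \<odot>\<^bsub>V\<^esub> x) = c \<odot>\<^bsub>quotient_space V W\<^esub> coset_map V W x"
    if x: "x \<in> carrier V" for c x
  proof -
    have eq: "coset_map V W (c \<odot>\<^bsub>V\<^esub> a) = coset_map V W (c \<odot>\<^bsub>V\<^esub> x)"
      if a: "a \<in> coset_map V W x" for a
    proof -
      obtain w where w: "w \<in> W" "a = w \<oplus>\<^bsub>V\<^esub> x"
        using a by (auto simp: coset_map_def a_r_coset_def')
      have "w \<in> carrier V" using w W.subset by auto
      then have "c \<odot>\<^bsub>V\<^esub> a = c \<odot>\<^bsub>V\<^esub> w \<oplus>\<^bsub>V\<^esub> c \<odot>\<^bsub>V\<^esub> x"
        using w x by (simp add: V.smult_r_distr)
      then show ?thesis
        using coset_map_add_subspace[OF assms, of "c \<odot>\<^bsub>V\<^esub> w" "c \<odot>\<^bsub>V\<^esub> x"] w x by simp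
    qed
    have "x \<in> coset_map V W x"
      using S.a_rcos_self[OF x] by (simp add: coset_map_def)
    then have "(\<Union>a\<in>coset_map V W x. coset_map V W (c \<odot>\<^bsub>V\<^esub> a)) = coset_map V W (c \<odot>\<^bsub>V\<^esub> x)"
      using eq by blast
    then show ?thesis
      by (simp add: quotient_space_def coset_map_def)
  qed
qed

lemma induced_op_coset_map:
  fixes X :: "('k::real_normed_field, 'v) normed" and Y :: "('k, 'w) normed"
  assumes U: "VectorSpace.subspace class_ring U X" and W: "VectorSpace.subspace class_ring W Y"
    and f: "f \<in> LinearCombinations.module_hom class_ring X Y"
    and fU: "f ` U \<subseteq> W" and x: "x \<in> carrier X"
  shows "induced_op Y W f (coset_map X U x) = coset_map Y W (f x)"
proof -
  interpret U: abelian_subgroup U X by (rule abelian_subgroup_subspace) fact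
  have eq: "coset_map Y W (f a) = coset_map Y W (f x)" if a: "a \<in> coset_map X U x" for a
  proof -
    obtain u where u: "u \<in> U" "a = u \<oplus>\<^bsub>X\<^esub> x"
      using a by (auto simp: coset_map_def a_r_coset_def')
    have "f a = f u \<oplus>\<^bsub>Y\<^esub> f x" "f x \<in> carrier Y"
      using f x u U.a_subset by (auto simp: LinearCombinations.module_hom_def)
    then show ?thesis
      using coset_map_add_subspace[OF W, of "f u" "f x"] fU u by auto
  qed
  have "x \<in> coset_map X U x"
    using U.a_rcos_self[OF x] by (simp add: coset_map_def)
  then show ?thesis
    unfolding induced_op_def using eq by blast
qed

definition fredholm_op ::
  "('k::real_normed_field, 'v) normed \<Rightarrow> ('k, 'w) normed \<Rightarrow> ('v \<Rightarrow> 'w) \<Rightarrow> bool" where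
  "fredholm_op X Y A \<longleftrightarrow>
     A \<in> bounded_ops X Y \<and>
     findim (restr X (a_kernel X Y A)) \<and>
     findim (quotient_space Y (A ` carrier X))"

text \<open>
  The algebraic direct sum with the \<open>\<ell>\<^sup>1\<close>-norm. In a chain only finitely many summands are nonzero,
  so that every element has finite support and all usual norms on the sum are equivalent.
\<close>

definition direct_sum_space ::
  "'i set \<Rightarrow> ('i \<Rightarrow> ('k::real_normed_field, 'v) normed) \<Rightarrow> ('k, 'i \<Rightarrow> 'v) normed" where
  "direct_sum_space I X =
     \<lparr>carrier = {f \<in> (\<Pi>\<^sub>E i\<in>I. carrier (X i)). finite {i\<in>I. f i \<noteq> \<zero>\<^bsub>X i\<^esub>}},
      mult = (\<lambda>_ _. \<lambda>i\<in>I. \<zero>\<^bsub>X i\<^esub>), one = (\<lambda>i\<in>I. \<zero>\<^bsub>X i\<^esub>),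
      zero = (\<lambda>i\<in>I. \<zero>\<^bsub>X i\<^esub>),
      add = (\<lambda>f g. \<lambda>i\<in>I. f i \<oplus>\<^bsub>X i\<^esub> g i),
      smult = (\<lambda>c f. \<lambda>i\<in>I. c \<odot>\<^bsub>X i\<^esub> f i),
      vnorm = (\<lambda>f. \<Sum>i\<in>{i\<in>I. f i \<noteq> \<zero>\<^bsub>X i\<^esub>}. vnorm (X i) (f i))\<rparr>"

text \<open>
  For \<open>d p\<close> mapping \<open>X p\<close> to \<open>X (p - 1)\<close>, the direct sum of the operators \<open>d (q + 1)\<close> with \<open>q \<in> J\<close>.
\<close>

definition direct_sum_op :: "int set \<Rightarrow> (int \<Rightarrow> 'v \<Rightarrow> 'v) \<Rightarrow> (int \<Rightarrow> 'v) \<Rightarrow> (int \<Rightarrow> 'v)" where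
  "direct_sum_op J d f = (\<lambda>q\<in>J. d (q + 1) (f (q + 1)))"

text \<open>
  That all \<open>X p\<close> have their elements in one type is no restriction: their carriers and operations
  are unrelated, and any family of sets can be embedded into a common type.
\<close>

definition banach_sequence ::
  "nat \<Rightarrow> (int \<Rightarrow> ('k::real_normed_field, 'v) normed) \<Rightarrow> (int \<Rightarrow> 'v \<Rightarrow> 'v) \<Rightarrow> bool" where
  "banach_sequence n X d \<longleftrightarrow>
     (\<forall>p. banach_space (X p)) \<and>
     (\<forall>p. d p \<in> bounded_ops (X p) (X (p - 1))) \<and>
     (\<forall>p. p < 0 \<or> p \<ge> int n + 1 \<longrightarrow> carrier (X p) = {\<zero>\<^bsub>X p\<^esub>}) \<and>
     (\<forall>p. p \<le> 0 \<or> p > int n \<longrightarrow> (\<forall>x\<in>carrier (X p). d p x = \<zero>\<^bsub>X (p - 1)\<^esub>))"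

definition fredholm_chain ::
  "(int \<Rightarrow> ('k::real_normed_field, 'v) normed) \<Rightarrow> (int \<Rightarrow> 'v \<Rightarrow> 'v) \<Rightarrow> bool" where
  "fredholm_chain X d \<longleftrightarrow>
     (\<exists>n. banach_sequence n X d) \<and>
     (\<forall>p. let N = a_kernel (X p) (X (p - 1)) (d p);
              R = d (p + 1) ` carrier (X (p + 1))
          in findim (quotient_space (restr (X p) N) (N \<inter> R)) \<and>
             findim (quotient_space (restr (X p) R) (N \<inter> R)))"

definition regular_fredholm_chain ::
  "(int \<Rightarrow> ('k::real_normed_field, 'v) normed) \<Rightarrow> (int \<Rightarrow> 'v \<Rightarrow> 'v) \<Rightarrow> bool" where
  "regular_fredholm_chain X d \<longleftrightarrow>
     fredholm_chain X d \<and>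
     (let Ev = {p. even p}; Od = {p. odd p}
      in regular_op (direct_sum_space Ev X) (direct_sum_space Od X) (direct_sum_op Od d) \<and>
         regular_op (direct_sum_space Od X) (direct_sum_space Ev X) (direct_sum_op Ev d))"

definition comp_range ::
  "(int \<Rightarrow> ('k::real_normed_field, 'v) normed) \<Rightarrow> (int \<Rightarrow> 'v \<Rightarrow> 'v) \<Rightarrow> int \<Rightarrow> 'v set" where
  "comp_range X d p = (\<lambda>x. d (p - 1) (d p x)) ` carrier (X p)"

definition quot_chain ::
  "(int \<Rightarrow> ('k::real_normed_field, 'v) normed) \<Rightarrow> (int \<Rightarrow> 'v \<Rightarrow> 'v) \<Rightarrow> int \<Rightarrow> ('k, 'v set) normed" where
  "quot_chain X d p = quotient_space (X p) (comp_range X d (p + 2))"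

definition quot_proj ::
  "(int \<Rightarrow> ('k::real_normed_field, 'v) normed) \<Rightarrow> (int \<Rightarrow> 'v \<Rightarrow> 'v) \<Rightarrow> int \<Rightarrow> 'v \<Rightarrow> 'v set" where
  "quot_proj X d p = coset_map (X p) (comp_range X d (p + 2))"

definition quot_op ::
  "(int \<Rightarrow> ('k::real_normed_field, 'v) normed) \<Rightarrow> (int \<Rightarrow> 'v \<Rightarrow> 'v) \<Rightarrow> int \<Rightarrow> 'v set \<Rightarrow> 'v set" where
  "quot_op X d p = induced_op (X (p - 1)) (comp_range X d (p - 1 + 2)) (d p)"

definition closed_complements ::
  "(int \<Rightarrow> ('k::real_normed_field, 'v) normed) \<Rightarrow> (int \<Rightarrow> 'v \<Rightarrow> 'v) \<Rightarrow> (int \<Rightarrow> 'v set) \<Rightarrow> bool" where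
  "closed_complements X d X0 \<longleftrightarrow>
     (\<forall>p. closed_subspace (X p) (X0 p) \<and>
          comp_range X d (p + 2) <+>\<^bsub>X p\<^esub> X0 p = carrier (X p) \<and>
          comp_range X d (p + 2) \<inter> X0 p = {\<zero>\<^bsub>X p\<^esub>})"

text \<open>\<open>D\<close> extends \<open>B\<close>, an operator between the quotients at \<open>p - 1\<close> and at \<open>p\<close>.\<close>

definition is_extension ::
  "(int \<Rightarrow> ('k::real_normed_field, 'v) normed) \<Rightarrow> (int \<Rightarrow> 'v \<Rightarrow> 'v) \<Rightarrow> (int \<Rightarrow> 'v set) \<Rightarrow> int \<Rightarrow>
     ('v set \<Rightarrow> 'v set) \<Rightarrow> ('v \<Rightarrow> 'v) \<Rightarrow> bool" where
  "is_extension X d X0 p B D \<longleftrightarrow>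
     D \<in> bounded_ops (X (p - 1)) (X p) \<and>
     (\<forall>x\<in>X0 (p - 1). D x = inv_into (X0 p) (quot_proj X d p) (B (quot_proj X d (p - 1) x)))"

end

theory Submission
  imports Defs
begin

text \<open>
  Extensions of generalized inverses of the induced operators invert \<open>\<delta>\<^sub>p\<close> up to the finite dimensional
  spaces divided out, so \<open>\<delta>\<^sub>p \<delta>\<^sub>p' \<delta>\<^sub>p - \<delta>\<^sub>p\<close> has finite rank, and so does \<open>\<delta>\<^sub>p \<delta>\<^sub>p\<^sub>+\<^sub>1\<close>. Hence \<open>P = \<delta>\<^sub>p\<^sub>+\<^sub>1 \<delta>\<^sub>p\<^sub>+\<^sub>1'\<close> and
  \<open>Q = \<delta>\<^sub>p' \<delta>\<^sub>p\<close> are, modulo finite rank, idempotents with \<open>Q P = 0\<close>, where \<open>P\<close> has range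
  \<open>R(\<delta>\<^sub>p\<^sub>+\<^sub>1)\<close> and \<open>Q\<close> has kernel \<open>N(\<delta>\<^sub>p)\<close>. Let \<open>D = P + Q\<close>. If \<open>D\<close> has a finite dimensional kernel and
  \<open>x \<in> N(\<delta>\<^sub>p)\<close>, then \<open>D x = P x = D P x\<close> modulo finite rank, so \<open>x - P x\<close> stays in a finite dimensional
  space. Conversely, if \<open>N(\<delta>\<^sub>p)\<close> lies in \<open>R(\<delta>\<^sub>p\<^sub>+\<^sub>1)\<close> up to a finite dimensional space, then
  \<open>(1 - P) (1 - Q) = 0\<close> modulo finite rank, that is \<open>D = 1 + P Q\<close>, whose inverse is \<open>1 - P Q\<close>
  because \<open>(P Q)\<^sup>2 = 0\<close>. The remaining conditions of a regular Fredholm chain hold automatically: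
  \<open>\<delta>\<^sub>p\<close> embeds \<open>R(\<delta>\<^sub>p\<^sub>+\<^sub>1) / (N(\<delta>\<^sub>p) \<inter> R(\<delta>\<^sub>p\<^sub>+\<^sub>1))\<close> into the finite dimensional range of
  \<open>\<delta>\<^sub>p \<delta>\<^sub>p\<^sub>+\<^sub>1\<close>, and generalized inverses of the \<open>\<delta>\<^sub>p\<close> add up to generalized inverses of their
  direct sums.
\<close>

section \<open>Subsets of finite dimensional subspaces\<close>

lemma (in abelian_group) minus_add_cancel_mid:
  assumes "a \<in> carrier G" "b \<in> carrier G" "c \<in> carrier G"
  shows "((a \<ominus> b) \<ominus> c) \<oplus> b = a \<ominus> c"
proof -
  have "((a \<ominus> b) \<ominus> c) \<oplus> b = (a \<ominus> c) \<oplus> (\<ominus> b \<oplus> b)"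
    unfolding minus_eq using assms by (simp add: a_ac)
  then show ?thesis using assms by (simp add: l_neg)
qed

lemma (in abelian_group) add_eq_imp_eq_minus:
  assumes "a \<oplus> c = b" "a \<in> carrier G" "c \<in> carrier G"
  shows "a = b \<ominus> c"
  using assms by (auto simp: minus_eq a_assoc r_neg)

lemma (in abelian_group) minus_eq_zero_iff:
  assumes "x \<in> carrier G" "y \<in> carrier G"
  shows "x \<ominus> y = \<zero> \<longleftrightarrow> x = y"
  using assms by (simp add: minus_eq) (metis a_inv_closed minus_equality minus_minus r_neg)

lemma set_addI: "a \<in> S \<Longrightarrow> b \<in> T \<Longrightarrow> a \<oplus>\<^bsub>V\<^esub> b \<in> S <+>\<^bsub>V\<^esub> T"
  unfolding set_add_def' by blast

text \<open>The set \<open>S\<close> need not be a subspace. Ranges of differences such as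
  \<open>A - A A' A\<close> and sums of such ranges can thus be bounded by a finite dimensional
  space without a proof that they are subspaces. A finite rank error means below that a difference
  of vectors stays in such a set.\<close>

definition fin_spanned :: "('a, 'm) ring_scheme \<Rightarrow> ('a, 'b, 'n) module_scheme \<Rightarrow> 'b set \<Rightarrow> bool" where
  "fin_spanned K V S \<longleftrightarrow>
     (\<exists>A. finite A \<and> A \<subseteq> carrier V \<and> S \<subseteq> LinearCombinations.module.span K V A)"

lemma fin_spanned_subset: "fin_spanned K V T \<Longrightarrow> S \<subseteq> T \<Longrightarrow> fin_spanned K V S"
  unfolding fin_spanned_def by blast

context vectorspace
begin

lemma fin_spanned_closed: "fin_spanned K V S \<Longrightarrow> x \<in> S \<Longrightarrow> x \<in> carrier V"
  unfolding fin_spanned_def using span_closed by blast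

lemma fin_spanned_add:
  assumes "fin_spanned K V S" "fin_spanned K V T"
  shows "fin_spanned K V (S <+>\<^bsub>V\<^esub> T)"
proof -
  obtain A where A: "finite A" "A \<subseteq> carrier V" "S \<subseteq> span A"
    using assms(1) by (auto simp: fin_spanned_def)
  obtain B where B: "finite B" "B \<subseteq> carrier V" "T \<subseteq> span B"
    using assms(2) by (auto simp: fin_spanned_def)
  have sub: "submodule K (span (A \<union> B)) V"
    using A B by (intro span_is_submodule) auto
  have "S \<subseteq> span (A \<union> B)" "T \<subseteq> span (A \<union> B)"
    using A B span_is_monotone[of A "A \<union> B"] span_is_monotone[of B "A \<union> B"] by auto
  then have "S <+>\<^bsub>V\<^esub> T \<subseteq> span (A \<union> B)"
    using submodule.m_closed[OF sub] unfolding set_add_def' by blast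
  then show ?thesis
    using A B unfolding fin_spanned_def by (intro exI[of _ "A \<union> B"]) auto
qed

lemma fin_spanned_uminus:
  assumes "fin_spanned K V S"
  shows "fin_spanned K V ((\<lambda>x. \<ominus>\<^bsub>V\<^esub> x) ` S)"
proof -
  obtain A where A: "finite A" "A \<subseteq> carrier V" "S \<subseteq> span A"
    using assms by (auto simp: fin_spanned_def)
  then have "(\<lambda>x. \<ominus>\<^bsub>V\<^esub> x) ` S \<subseteq> span A"
    using span_neg by auto
  then show ?thesis
    using A unfolding fin_spanned_def by blast
qed

lemma fin_spanned_restrictD:
  assumes "subspace K W V" "fin_spanned K (V\<lparr>carrier := W\<rparr>) S"
  shows "fin_spanned K V S"
proof -
  have W: "submodule K W V" using assms(1) by simp
  then have "W \<subseteq> carrier V" by (simp add: submodule_def)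
  moreover obtain A where "finite A" "A \<subseteq> W"
      "S \<subseteq> LinearCombinations.module.span K (V\<lparr>carrier := W\<rparr>) A"
    using assms(2) by (auto simp: fin_spanned_def)
  ultimately show ?thesis
    using span_li_not_depend(1)[OF _ W] unfolding fin_spanned_def by (intro exI[of _ A]) auto
qed

lemma fin_dim_iff_fin_spanned: "fin_dim \<longleftrightarrow> fin_spanned K V (carrier V)"
proof -
  have "span A = carrier V \<longleftrightarrow> carrier V \<subseteq> span A" if "A \<subseteq> carrier V" for A
    using span_closed[OF that] by blast
  then show ?thesis
    unfolding fin_dim_def fin_spanned_def by blast
qed

text \<open>Subspaces of finite dimensional spaces are finite dimensional: by exchange inside
  \<open>span A\<close>, independent subsets of \<open>W\<close> have at most \<open>card A\<close>
  elements, so a maximal one exists and is a finite basis of \<open>W\<close>.\<close>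

lemma fin_dim_restrict_iff:
  assumes W: "subspace K W V"
  shows "vectorspace.fin_dim K (V\<lparr>carrier := W\<rparr>) \<longleftrightarrow> fin_spanned K V W"
proof -
  have sW: "submodule K W V" using W by simp
  have WC: "W \<subseteq> carrier V" using sW by (simp add: submodule_def)
  interpret W: vectorspace K "V\<lparr>carrier := W\<rparr>" by (rule subspace_is_vs[OF W])
  show ?thesis
  proof
    assume "W.fin_dim"
    then show "fin_spanned K V W"
      using fin_spanned_restrictD[OF W] by (simp add: W.fin_dim_iff_fin_spanned)
  next
    assume "fin_spanned K V W"
    then obtain A where A: "finite A" "A \<subseteq> carrier V" "W \<subseteq> span A"
      by (auto simp: fin_spanned_def)
    have sub: "subspace K (span A) V" "submodule K (span A) V"
      using A by (auto intro: span_is_subspace span_is_submodule)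
    interpret S: vectorspace K "V\<lparr>carrier := span A\<rparr>"
      by (rule subspace_is_vs[OF sub(1)])
    have As: "A \<subseteq> span A" using in_own_span A by auto
    have gen: "S.span A = span A"
      using span_li_not_depend(1)[OF As sub(2)] by simp
    have bound: "finite B \<and> card B \<le> card A" if "B \<subseteq> W \<and> W.lin_indpt B" for B
    proof -
      have B: "B \<subseteq> W" "B \<subseteq> span A" "S.lin_indpt B"
        using span_li_not_depend(2)[OF _ sW, of B] span_li_not_depend(2)[OF _ sub(2), of B] that A
        by auto
      have "S.fin_dim"
        unfolding S.fin_dim_def using A As gen by (intro exI[of _ A]) auto
      then have "finite B" using S.fin_dim_li_fin B by auto
      moreover have "card B \<le> card A"
        using S.li_smaller_than_gen[OF \<open>finite B\<close> A(1)] B As gen by auto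
      ultimately show ?thesis by blast
    qed
    have "{} \<subseteq> W \<and> W.lin_indpt {}"
      by (auto simp: W.lin_dep_def)
    from maximal_exists[where P = "\<lambda>B. B \<subseteq> W \<and> W.lin_indpt B", OF bound this]
    obtain B where "finite B" "maximal B (\<lambda>B. B \<subseteq> W \<and> W.lin_indpt B)"
      by blast
    then have "W.basis B" using W.max_li_is_basis by simp
    with \<open>finite B\<close> show "W.fin_dim"
      unfolding W.fin_dim_def W.basis_def by blast
  qed
qed

end

section \<open>Linear maps and finite dimensional spans\<close>

lemma linear_mapI:
  assumes "vectorspace K V" "vectorspace K W" "T \<in> module_hom K V W"
  shows "linear_map K V W T"
  using assms
  by (auto intro!: linear_map.intro mod_hom.intro mod_hom_axioms.intro simp: vectorspace_def)

lemma linear_map_comp: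
  assumes "linear_map K U V S" "linear_map K V W T"
  shows "linear_map K U W (\<lambda>x. T (S x))"
proof -
  interpret S: linear_map K U V S by fact
  interpret T: linear_map K V W T by fact
  have "(\<lambda>x. T (S x)) \<in> module_hom K U W"
    by (auto simp: module_hom_def)
  then show ?thesis by (intro linear_mapI) unfold_locales
qed

context linear_map
begin

lemma linear_map_restrict:
  assumes "subspace K N V"
  shows "linear_map K (V\<lparr>carrier := N\<rparr>) W T"
proof (rule linear_mapI[OF V.subspace_is_vs[OF assms]])
  show "vectorspace K W" by unfold_locales
  have "N \<subseteq> carrier V" using assms by (simp add: subspace_def submodule_def)
  then show "T \<in> module_hom K (V\<lparr>carrier := N\<rparr>) W"
    unfolding module_hom_def by (auto simp: subset_iff)
qed

text \<open>The vectors that \<open>T\<close> sends into the span of the images of \<open>A\<close>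
  form a submodule containing \<open>A\<close>, hence containing \<open>span A\<close>.\<close>

lemma fin_spanned_image:
  assumes "fin_spanned K V S"
  shows "fin_spanned K W (T ` S)"
proof -
  obtain A where A: "finite A" "A \<subseteq> carrier V" "S \<subseteq> V.module.span A"
    using assms by (auto simp: fin_spanned_def)
  have TA: "T ` A \<subseteq> carrier W" using A by auto
  interpret I: submodule K "W.module.span (T ` A)" W by (rule W.module.span_is_submodule[OF TA])
  have "submodule K {v \<in> carrier V. T v \<in> W.module.span (T ` A)} V"
    by unfold_locales auto
  moreover have "A \<subseteq> {v \<in> carrier V. T v \<in> W.module.span (T ` A)}"
    using A W.module.in_own_span[OF TA] by auto
  ultimately have "V.module.span A \<subseteq> {v \<in> carrier V. T v \<in> W.module.span (T ` A)}"
    by (rule V.module.span_is_subset[rotated])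
  then show ?thesis
    unfolding fin_spanned_def using A TA by (intro exI[of _ "T ` A"]) auto
qed

text \<open>Only the part of \<open>S\<close> inside the range of \<open>T\<close> can be lifted.
  The intersection of that range with \<open>span A\<close> is finite dimensional, and preimages of
  finitely many generators of it span a suitable \<open>G\<close>.\<close>

lemma fin_spanned_lift:
  assumes "fin_spanned K W S"
  obtains G where "fin_spanned K V G" "\<And>x. x \<in> carrier V \<Longrightarrow> T x \<in> S \<Longrightarrow> \<exists>g\<in>G. T g = T x"
proof -
  obtain A where A: "finite A" "A \<subseteq> carrier W" "S \<subseteq> W.module.span A"
    using assms by (auto simp: fin_spanned_def)
  interpret I: submodule K "W.module.span A" W by (rule W.module.span_is_submodule[OF A(2)])
  interpret M: submodule K im W by (rule im_is_submodule)
  define R where "R = W.module.span A \<inter> im"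
  have sub: "subspace K R W"
    unfolding R_def by (unfold_locales) (use I.subset in auto)
  then have "vectorspace.fin_dim K (W\<lparr>carrier := R\<rparr>)"
    using A by (auto simp: W.fin_dim_restrict_iff R_def fin_spanned_def)
  then obtain B where B: "finite B" "B \<subseteq> R" "LinearCombinations.module.span K (W\<lparr>carrier := R\<rparr>) B = R"
    using vectorspace.fin_dim_def[OF W.subspace_is_vs[OF sub]] by auto
  have BR: "W.module.span B = R"
    using W.module.span_li_not_depend(1)[OF B(2)] sub B(3) by simp
  have "\<forall>b\<in>B. \<exists>c\<in>carrier V. T c = b"
    using B(2) by (auto simp: R_def im_def)
  then obtain c where c: "\<And>b. b \<in> B \<Longrightarrow> c b \<in> carrier V \<and> T (c b) = b"
    by metis
  have cB: "c ` B \<subseteq> carrier V" using c by auto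
  interpret C: submodule K "V.module.span (c ` B)" V by (rule V.module.span_is_submodule[OF cB])
  interpret L: linear_map K "V\<lparr>carrier := V.module.span (c ` B)\<rparr>" W T
    by (rule linear_map_restrict[OF V.span_is_subspace[OF cB]])
  have "B \<subseteq> L.im"
  proof
    fix b assume "b \<in> B"
    then show "b \<in> L.im"
      using c[of b] V.module.in_own_span[OF cB] by (auto simp: L.im_def image_iff intro!: bexI[of _ "c b"])
  qed
  then have "R \<subseteq> T ` V.module.span (c ` B)"
    using W.module.span_is_subset[OF _ L.im_is_submodule] BR by (auto simp: L.im_def)
  then have "\<exists>g\<in>V.module.span (c ` B). T g = T x" if "x \<in> carrier V" "T x \<in> S" for x
    using that A(3) by (force simp: R_def im_def)
  moreover have "fin_spanned K V (V.module.span (c ` B))"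
    unfolding fin_spanned_def using B(1) cB by blast
  ultimately show thesis using that by blast
qed

text \<open>Subtracting from \<open>x\<close> a lift of \<open>T x\<close> taken from a finite
  dimensional set leaves a vector of the kernel, so the preimage lies in the sum of the kernel and
  that set.\<close>

lemma fin_spanned_vimage:
  assumes "fin_spanned K W S" "fin_spanned K V ker"
  shows "fin_spanned K V {x \<in> carrier V. T x \<in> S}"
proof -
  obtain G where G: "fin_spanned K V G" "\<And>x. x \<in> carrier V \<Longrightarrow> T x \<in> S \<Longrightarrow> \<exists>g\<in>G. T g = T x"
    using fin_spanned_lift[OF assms(1)] by blast
  have "{x \<in> carrier V. T x \<in> S} \<subseteq> ker <+>\<^bsub>V\<^esub> G"
  proof
    fix x assume "x \<in> {x \<in> carrier V. T x \<in> S}"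
    then obtain g where x: "x \<in> carrier V" "g \<in> G" "T g = T x" using G(2) by blast
    moreover have g: "g \<in> carrier V" using V.fin_spanned_closed[OF G(1)] x by auto
    ultimately have "x \<ominus>\<^bsub>V\<^esub> g \<in> ker" "x = (x \<ominus>\<^bsub>V\<^esub> g) \<oplus>\<^bsub>V\<^esub> g"
      by (auto simp: ker_def V.module.M.minus_eq V.module.M.a_assoc V.module.M.l_neg W.module.M.r_neg)
    with x show "x \<in> ker <+>\<^bsub>V\<^esub> G" unfolding set_add_def' by blast
  qed
  then show ?thesis
    using V.fin_spanned_add[OF assms(2) G(1)] fin_spanned_subset by blast
qed

end

section \<open>Quotient spaces\<close>

text \<open>Every element of \<open>Q\<close> has the form \<open>f x\<close> and \<open>f\<close>
  respects the operations, so each axiom is inherited from \<open>V\<close>. This is what makes the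
  quotient records vector spaces.\<close>

lemma vectorspace_surj_image:
  fixes Q :: "('k::field, 'b, 'q) module_scheme" and V :: "('k, 'a, 'm) module_scheme"
  assumes "vectorspace class_ring V" and surj: "f ` carrier V = carrier Q"
    and add: "\<And>x y. x \<in> carrier V \<Longrightarrow> y \<in> carrier V \<Longrightarrow> f (x \<oplus>\<^bsub>V\<^esub> y) = f x \<oplus>\<^bsub>Q\<^esub> f y"
    and smult: "\<And>c x. x \<in> carrier V \<Longrightarrow> f (c \<odot>\<^bsub>V\<^esub> x) = c \<odot>\<^bsub>Q\<^esub> f x"
    and zero: "f \<zero>\<^bsub>V\<^esub> = \<zero>\<^bsub>Q\<^esub>"
  shows "vectorspace class_ring Q"
proof -
  interpret V: vectorspace class_ring V by fact
  have ex: "\<exists>x\<in>carrier V. v = f x" if "v \<in> carrier Q" for v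
    using that surj by blast
  have closed: "f x \<in> carrier Q" if "x \<in> carrier V" for x
    using that surj by blast
  have neg: "\<exists>w\<in>carrier Q. v \<oplus>\<^bsub>Q\<^esub> w = \<zero>\<^bsub>Q\<^esub>" if v: "v \<in> carrier Q" for v
  proof -
    obtain x where x: "x \<in> carrier V" "v = f x" using ex[OF v] by blast
    then have "v \<oplus>\<^bsub>Q\<^esub> f (\<ominus>\<^bsub>V\<^esub> x) = \<zero>\<^bsub>Q\<^esub>"
      using add[of x "\<ominus>\<^bsub>V\<^esub> x"] by (simp add: V.r_neg zero)
    then show ?thesis using closed x by blast
  qed
  show ?thesis
  proof (rule vs_criteria)
    show "field (class_ring :: 'k ring)" by (rule class_field)
    show "\<zero>\<^bsub>Q\<^esub> \<in> carrier Q" using closed[of "\<zero>\<^bsub>V\<^esub>"] zero by simp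
    show "\<forall>v\<in>carrier Q. \<exists>w\<in>carrier Q. v \<oplus>\<^bsub>Q\<^esub> w = \<zero>\<^bsub>Q\<^esub>" using neg by blast
    show "\<forall>v w. v \<in> carrier Q \<and> w \<in> carrier Q \<longrightarrow> v \<oplus>\<^bsub>Q\<^esub> w \<in> carrier Q"
      by (auto dest!: ex simp: add[symmetric] intro!: closed)
    show "\<forall>c v. c \<in> carrier class_ring \<and> v \<in> carrier Q \<longrightarrow> c \<odot>\<^bsub>Q\<^esub> v \<in> carrier Q"
      by (auto dest!: ex simp: smult[symmetric] intro!: closed)
    show "\<forall>v w. v \<in> carrier Q \<and> w \<in> carrier Q \<longrightarrow> v \<oplus>\<^bsub>Q\<^esub> w = w \<oplus>\<^bsub>Q\<^esub> v"
      by (auto dest!: ex simp: add[symmetric] V.a_comm)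
    show "\<forall>v w x. v \<in> carrier Q \<and> w \<in> carrier Q \<and> x \<in> carrier Q \<longrightarrow>
        (v \<oplus>\<^bsub>Q\<^esub> w) \<oplus>\<^bsub>Q\<^esub> x = v \<oplus>\<^bsub>Q\<^esub> (w \<oplus>\<^bsub>Q\<^esub> x)"
      by (auto dest!: ex simp: add[symmetric] V.a_assoc)
    show "\<forall>v\<in>carrier Q. v \<oplus>\<^bsub>Q\<^esub> \<zero>\<^bsub>Q\<^esub> = v"
      by (auto dest!: ex simp: add[symmetric] zero[symmetric])
    show "\<forall>a b v. a \<in> carrier class_ring \<and> b \<in> carrier class_ring \<and> v \<in> carrier Q \<longrightarrow>
        (a \<otimes>\<^bsub>class_ring\<^esub> b) \<odot>\<^bsub>Q\<^esub> v = a \<odot>\<^bsub>Q\<^esub> (b \<odot>\<^bsub>Q\<^esub> v)"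
      using V.smult_assoc1 by (auto dest!: ex simp: smult[symmetric])
    show "\<forall>v\<in>carrier Q. \<one>\<^bsub>class_ring\<^esub> \<odot>\<^bsub>Q\<^esub> v = v"
      using V.smult_one by (auto dest!: ex simp: smult[symmetric])
    show "\<forall>a b v. a \<in> carrier class_ring \<and> b \<in> carrier class_ring \<and> v \<in> carrier Q \<longrightarrow>
        (a \<oplus>\<^bsub>class_ring\<^esub> b) \<odot>\<^bsub>Q\<^esub> v = (a \<odot>\<^bsub>Q\<^esub> v) \<oplus>\<^bsub>Q\<^esub> (b \<odot>\<^bsub>Q\<^esub> v)"
      using V.smult_l_distr by (auto dest!: ex simp: smult[symmetric] add[symmetric])
    show "\<forall>a v w. a \<in> carrier class_ring \<and> v \<in> carrier Q \<and> w \<in> carrier Q \<longrightarrow>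
        a \<odot>\<^bsub>Q\<^esub> (v \<oplus>\<^bsub>Q\<^esub> w) = (a \<odot>\<^bsub>Q\<^esub> v) \<oplus>\<^bsub>Q\<^esub> (a \<odot>\<^bsub>Q\<^esub> w)"
      using V.smult_r_distr by (auto dest!: ex simp: smult[symmetric] add[symmetric])
  qed
qed

context
  fixes V :: "('k::real_normed_field, 'v) normed" and W
  assumes W: "VectorSpace.subspace class_ring W V"
begin

interpretation V: vectorspace class_ring V using W by (simp add: VectorSpace.subspace_def)
interpretation S: abelian_subgroup W V by (rule abelian_subgroup_subspace) (rule W)

lemma coset_map_surj: "coset_map V W ` carrier V = carrier (quotient_space V W)"
  by (auto simp: quotient_space_def coset_map_def A_RCOSETS_def')

lemma coset_map_eq_zero_iff:
  "x \<in> carrier V \<Longrightarrow> coset_map V W x = \<zero>\<^bsub>quotient_space V W\<^esub> \<longleftrightarrow> x \<in> W"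
  using S.a_rcos_self[of x] S.a_rcos_const by (auto simp: coset_map_def quotient_space_def)

lemma linear_map_coset_map: "linear_map class_ring V (quotient_space V W) (coset_map V W)"
proof (rule linear_mapI)
  show "vectorspace class_ring V" by unfold_locales
  show "vectorspace class_ring (quotient_space V W)"
    using coset_map_surj quotient_space_operations[OF W] coset_map_eq_zero_iff[of "\<zero>\<^bsub>V\<^esub>"]
    by (intro vectorspace_surj_image[of V "coset_map V W"]) (auto, unfold_locales)
  show "coset_map V W \<in> module_hom class_ring V (quotient_space V W)"
    using coset_map_surj by (simp add: module_hom_def quotient_space_operations[OF W] Pi_iff) blast
qed

lemma coset_map_eq_iff:
  assumes "x \<in> carrier V" "y \<in> carrier V"
  shows "coset_map V W x = coset_map V W y \<longleftrightarrow> x \<ominus>\<^bsub>V\<^esub> y \<in> W"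
proof -
  interpret c: linear_map class_ring V "quotient_space V W" "coset_map V W"
    by (rule linear_map_coset_map)
  have "coset_map V W (x \<ominus>\<^bsub>V\<^esub> y) = coset_map V W x \<ominus>\<^bsub>quotient_space V W\<^esub> coset_map V W y"
    using assms by simp
  moreover have "x \<ominus>\<^bsub>V\<^esub> y \<in> carrier V" using assms by simp
  ultimately show ?thesis
    using assms coset_map_eq_zero_iff[of "x \<ominus>\<^bsub>V\<^esub> y"] c.W.module.M.minus_eq_zero_iff[of "coset_map V W x" "coset_map V W y"]
    by auto
qed

text \<open>Finite codimension is expressed here by vectors instead of cosets. For one direction
  \<open>G\<close> lifts the whole quotient through the coset map; for the other the cosets of
  elements of \<open>G\<close> exhaust the quotient.\<close>

lemma findim_quotient_space_iff:
  "findim (quotient_space V W) \<longleftrightarrow>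
     (\<exists>G. fin_spanned class_ring V G \<and> (\<forall>x\<in>carrier V. \<exists>w\<in>W. x \<ominus>\<^bsub>V\<^esub> w \<in> G))"
proof -
  interpret c: linear_map class_ring V "quotient_space V W" "coset_map V W"
    by (rule linear_map_coset_map)
  show ?thesis
  proof
    assume "findim (quotient_space V W)"
    then have "fin_spanned class_ring (quotient_space V W) (carrier (quotient_space V W))"
      by (simp add: c.W.fin_dim_iff_fin_spanned)
    then obtain G where G: "fin_spanned class_ring V G" "\<And>x. x \<in> carrier V \<Longrightarrow>
        \<exists>g\<in>G. coset_map V W g = coset_map V W x"
      using c.fin_spanned_lift by (metis c.f_im)
    have "\<exists>w\<in>W. x \<ominus>\<^bsub>V\<^esub> w \<in> G" if x: "x \<in> carrier V" for x
    proof -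
      obtain g where g: "g \<in> G" "coset_map V W x = coset_map V W g" using G(2) x by metis
      then have "g \<in> carrier V" using V.fin_spanned_closed G(1) by blast
      with x g have "x \<ominus>\<^bsub>V\<^esub> g \<in> W" "x \<ominus>\<^bsub>V\<^esub> (x \<ominus>\<^bsub>V\<^esub> g) = g"
        by (auto simp: coset_map_eq_iff V.minus_eq V.minus_add V.r_neg1 V.r_neg2)
      with g(1) show ?thesis by metis
    qed
    with G(1) show "\<exists>G. fin_spanned class_ring V G \<and> (\<forall>x\<in>carrier V. \<exists>w\<in>W. x \<ominus>\<^bsub>V\<^esub> w \<in> G)"
      by blast
  next
    assume "\<exists>G. fin_spanned class_ring V G \<and> (\<forall>x\<in>carrier V. \<exists>w\<in>W. x \<ominus>\<^bsub>V\<^esub> w \<in> G)"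
    then obtain G where G: "fin_spanned class_ring V G" "\<forall>x\<in>carrier V. \<exists>w\<in>W. x \<ominus>\<^bsub>V\<^esub> w \<in> G"
      by blast
    have "carrier (quotient_space V W) \<subseteq> coset_map V W ` G"
    proof
      fix A assume "A \<in> carrier (quotient_space V W)"
      then obtain x where x: "x \<in> carrier V" "A = coset_map V W x"
        using coset_map_surj by blast
      then obtain w where w: "w \<in> W" "x \<ominus>\<^bsub>V\<^esub> w \<in> G" using G(2) by blast
      have wV: "w \<in> carrier V" using w S.a_subset by auto
      have "coset_map V W (x \<ominus>\<^bsub>V\<^esub> w) = A \<ominus>\<^bsub>quotient_space V W\<^esub> \<zero>\<^bsub>quotient_space V W\<^esub>"
        using x wV w(1) coset_map_eq_zero_iff[OF wV] by simp
      also have "\<dots> = A"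
        using c.W.module.M.add_eq_imp_eq_minus[of A _ A] x by auto
      finally show "A \<in> coset_map V W ` G" using w by blast
    qed
    then show "findim (quotient_space V W)"
      unfolding c.W.fin_dim_iff_fin_spanned
      using c.fin_spanned_image[OF G(1)] fin_spanned_subset by blast
  qed
qed

end

lemma (in linear_map) subspace_ker_image: "subspace K ker V" "subspace K (T ` carrier V) W"
  using kerT_is_subspace imT_is_subspace by (simp_all add: im_def)

text \<open>This is the isomorphism of \<open>V\<close> modulo the kernel with the range, used in
  the form that a lift of the range is a complement of the kernel up to a finite dimensional
  set.\<close>

lemma findim_quotient_ker:
  fixes V :: "('k::real_normed_field, 'v) normed"
  assumes "linear_map class_ring V Y f" "fin_spanned class_ring Y (f ` carrier V)"
  shows "findim (quotient_space V (mod_hom.ker V Y f))"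
proof -
  interpret linear_map class_ring V Y f by fact
  obtain G where G: "fin_spanned class_ring V G"
    "\<And>x. x \<in> carrier V \<Longrightarrow> f x \<in> f ` carrier V \<Longrightarrow> \<exists>g\<in>G. f g = f x"
    using fin_spanned_lift[OF assms(2)] by blast
  have "\<exists>w\<in>ker. x \<ominus>\<^bsub>V\<^esub> w \<in> G" if x: "x \<in> carrier V" for x
  proof -
    obtain g where g: "g \<in> G" "f g = f x" using G(2)[OF x imageI[OF x]] by blast
    then have "g \<in> carrier V" using V.fin_spanned_closed G(1) by blast
    with x g have "x \<ominus>\<^bsub>V\<^esub> g \<in> ker" "x \<ominus>\<^bsub>V\<^esub> (x \<ominus>\<^bsub>V\<^esub> g) = g"
      by (auto simp: ker_def V.module.M.minus_eq V.module.M.minus_add V.module.M.r_neg1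
          V.module.M.r_neg2 W.module.M.r_neg)
    with g(1) show ?thesis by metis
  qed
  with G(1) show ?thesis
    using findim_quotient_space_iff[OF subspace_ker_image(1)] by blast
qed

section \<open>The operator modulo finite rank\<close>

text \<open>One place of the chain in purely algebraic form: \<open>A\<close> stands for the
  operator arriving at \<open>V\<close>, \<open>B\<close> for the one leaving it, and
  \<open>A'\<close>, \<open>B'\<close> for the extensions. The equations \<open>A A' A = A\<close>,
  \<open>B B' B = B\<close> and \<open>B A = 0\<close> are only required up to finite rank.\<close>

locale regular_pair =
  A: linear_map K U V A + A': linear_map K V U A' + B: linear_map K V W B + B': linear_map K W V B'
  for K U V W A A' B B' +
  assumes A_inv: "fin_spanned K V ((\<lambda>u. A u \<ominus>\<^bsub>V\<^esub> A (A' (A u))) ` carrier U)"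
    and B_inv: "fin_spanned K W ((\<lambda>x. B x \<ominus>\<^bsub>W\<^esub> B (B' (B x))) ` carrier V)"
    and BA: "fin_spanned K W ((\<lambda>u. B (A u)) ` carrier U)"
begin

definition D where "D x = A (A' x) \<oplus>\<^bsub>V\<^esub> B' (B x)"

lemma D_linear: "linear_map K V V D"
proof (rule linear_mapI)
  show "D \<in> module_hom K V V"
    unfolding module_hom_def D_def
    by (auto simp: A.W.module.M.a_ac A.W.module.smult_r_distr)
qed unfold_locales

sublocale D: linear_map K V V D by (rule D_linear)

text \<open>For \<open>x\<close> in the kernel of \<open>B\<close> the vector
  \<open>D (x - A (A' x))\<close> lies in a fixed finite dimensional set, made of the errors in
  \<open>A A' A = A\<close> and \<open>B A = 0\<close>. Its preimage under \<open>D\<close> is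
  finitely spanned because the kernel of \<open>D\<close> is.\<close>

lemma kernel_near_range:
  assumes "fin_spanned K V D.ker"
  obtains G where "fin_spanned K V G"
    "\<And>x. x \<in> carrier V \<Longrightarrow> B x = \<zero>\<^bsub>W\<^esub> \<Longrightarrow> \<exists>u\<in>carrier U. x \<ominus>\<^bsub>V\<^esub> A u \<in> G"
proof -
  let ?S = "(\<lambda>u. A u \<ominus>\<^bsub>V\<^esub> A (A' (A u))) ` carrier U <+>\<^bsub>V\<^esub> B' ` ((\<lambda>u. B (A u)) ` carrier U)"
  let ?G = "{y \<in> carrier V. D y \<in> ?S}"
  have "fin_spanned K V ?G"
    by (intro D.fin_spanned_vimage A.W.fin_spanned_add A_inv B'.fin_spanned_image BA assms)
  moreover have "\<exists>u\<in>carrier U. x \<ominus>\<^bsub>V\<^esub> A u \<in> ?G" if x: "x \<in> carrier V" "B x = \<zero>\<^bsub>W\<^esub>" for x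
  proof (intro bexI)
    let ?v = "A' x"
    show v: "?v \<in> carrier U" using x by simp
    have "D (x \<ominus>\<^bsub>V\<^esub> A ?v) = D x \<ominus>\<^bsub>V\<^esub> D (A ?v)"
      using x by simp
    also have "D x = A ?v"
      using x by (simp add: D_def)
    \<comment> \<open>The minus sign is moved inside onto \<open>?v\<close>, so that the last term
      is visibly an element of the range of \<open>B' B A\<close>.\<close>
    also have "A ?v \<ominus>\<^bsub>V\<^esub> D (A ?v) = (A ?v \<ominus>\<^bsub>V\<^esub> A (A' (A ?v))) \<oplus>\<^bsub>V\<^esub> B' (B (A (\<ominus>\<^bsub>U\<^esub> ?v)))"
      using v by (simp add: D_def A.W.module.M.minus_eq A.W.module.M.minus_add A.W.module.M.a_assoc)
    also have "\<dots> \<in> ?S"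
      by (intro set_addI imageI) (use v in auto)
    finally show "x \<ominus>\<^bsub>V\<^esub> A ?v \<in> ?G" using x by simp
  qed
  ultimately show thesis using that by blast
qed

text \<open>With \<open>P = A A'\<close> and \<open>Q = B' B\<close> the vector in question is
  \<open>(1 - P) (1 - Q) x\<close>. Up to finite dimensional errors, \<open>1 - Q\<close> maps into
  the kernel of \<open>B\<close>, which lies in the range of \<open>A\<close>, which
  \<open>1 - P\<close> annihilates.\<close>

lemma complement_product_finite_rank:
  assumes G: "fin_spanned K V G"
    and near: "\<And>x. x \<in> carrier V \<Longrightarrow> B x = \<zero>\<^bsub>W\<^esub> \<Longrightarrow> \<exists>u\<in>carrier U. x \<ominus>\<^bsub>V\<^esub> A u \<in> G"
  obtains H where "fin_spanned K V H"
    "\<And>x. x \<in> carrier V \<Longrightarrow> (x \<oplus>\<^bsub>V\<^esub> A (A' (B' (B x)))) \<ominus>\<^bsub>V\<^esub> D x \<in> H"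
proof -
  obtain G1 where G1: "fin_spanned K V G1" "\<And>x. x \<in> carrier V \<Longrightarrow>
      B x \<in> (\<lambda>x. B x \<ominus>\<^bsub>W\<^esub> B (B' (B x))) ` carrier V \<Longrightarrow> \<exists>g\<in>G1. B g = B x"
    using B.fin_spanned_lift[OF B_inv] by blast
  let ?c = "\<lambda>x. x \<ominus>\<^bsub>V\<^esub> A (A' x)"
  have lin: "linear_map K V V ?c"
  proof (rule linear_mapI)
    show "?c \<in> module_hom K V V"
      unfolding module_hom_def
      by (auto simp: A.W.module.M.minus_eq A.W.module.M.minus_add A.W.module.M.a_ac A.W.module.smult_r_distr A.W.module.smult_r_minus)
  qed unfold_locales
  interpret c: linear_map K V V ?c by (rule lin)
  let ?H = "(\<lambda>u. A u \<ominus>\<^bsub>V\<^esub> A (A' (A u))) ` carrier U <+>\<^bsub>V\<^esub> ?c ` (G <+>\<^bsub>V\<^esub> G1)"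
  have "fin_spanned K V ?H"
    by (intro A.W.fin_spanned_add A_inv c.fin_spanned_image G G1)
  moreover have "(x \<oplus>\<^bsub>V\<^esub> A (A' (B' (B x)))) \<ominus>\<^bsub>V\<^esub> D x \<in> ?H" if x: "x \<in> carrier V" for x
  proof -
    define y where "y = x \<ominus>\<^bsub>V\<^esub> B' (B x)"
    have y: "y \<in> carrier V" using x by (simp add: y_def)
    have "B y \<in> (\<lambda>x. B x \<ominus>\<^bsub>W\<^esub> B (B' (B x))) ` carrier V"
      using x by (auto simp: y_def)
    then obtain g1 where g1: "g1 \<in> G1" "B g1 = B y" using G1(2) y by blast
    have g1V: "g1 \<in> carrier V" using A.W.fin_spanned_closed[OF G1(1) g1(1)] .
    \<comment> \<open>The vector \<open>B y\<close> is only small, not zero. Subtracting the lift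
      \<open>g1\<close> of it gives a genuine kernel vector, to which \<open>near\<close>
      applies.\<close>
    have "B (y \<ominus>\<^bsub>V\<^esub> g1) = \<zero>\<^bsub>W\<^esub>"
      using y g1 g1V by (simp add: B.W.module.M.minus_eq B.W.module.M.r_neg)
    then obtain u where u: "u \<in> carrier U" "(y \<ominus>\<^bsub>V\<^esub> g1) \<ominus>\<^bsub>V\<^esub> A u \<in> G"
      using near[of "y \<ominus>\<^bsub>V\<^esub> g1"] y g1V by auto
    define g where "g = (y \<ominus>\<^bsub>V\<^esub> g1) \<ominus>\<^bsub>V\<^esub> A u"
    have g: "g \<in> G" "g \<in> carrier V" using u y g1V by (auto simp: g_def)
    \<comment> \<open>This decomposes \<open>y\<close> into a vector of the range of
      \<open>A\<close> and the two corrections \<open>g\<close> and \<open>g1\<close>, matching the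
      two summands of \<open>?H\<close> after \<open>?c = 1 - P\<close> is applied.\<close>
    have "g \<oplus>\<^bsub>V\<^esub> g1 = y \<ominus>\<^bsub>V\<^esub> A u"
      unfolding g_def by (rule A.W.module.M.minus_add_cancel_mid) (use y g1V u in auto)
    then have eq: "y = A u \<oplus>\<^bsub>V\<^esub> (g \<oplus>\<^bsub>V\<^esub> g1)"
      using y u by (simp add: A.W.module.M.minus_eq A.W.module.M.a_lcomm[of "A u" y] A.W.module.M.r_neg)
    have "(x \<oplus>\<^bsub>V\<^esub> A (A' (B' (B x)))) \<ominus>\<^bsub>V\<^esub> D x = ?c y"
      using x by (simp add: y_def D_def A.W.module.M.minus_eq A.W.module.M.minus_add A.W.module.M.a_ac)
    also have "\<dots> = ?c (A u) \<oplus>\<^bsub>V\<^esub> ?c (g \<oplus>\<^bsub>V\<^esub> g1)"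
      unfolding eq by (rule c.T_add) (use u g g1V in auto)
    also have "\<dots> \<in> ?H"
      using u g g1 unfolding set_add_def' by blast
    finally show ?thesis .
  qed
  ultimately show thesis using that by blast
qed

text \<open>Up to finite rank \<open>D = 1 + P Q\<close>, and \<open>Q P = B' (B A) A'\<close> has
  finite rank, so \<open>1 - P Q\<close> inverts \<open>D\<close> up to finite rank. The first
  conclusion bounds the kernel, the second the cokernel.\<close>

lemma fredholm_if_kernel_near_range:
  assumes G: "fin_spanned K V G"
    and near: "\<And>x. x \<in> carrier V \<Longrightarrow> B x = \<zero>\<^bsub>W\<^esub> \<Longrightarrow> \<exists>u\<in>carrier U. x \<ominus>\<^bsub>V\<^esub> A u \<in> G"
  shows "fin_spanned K V D.ker"
    and "\<exists>L. fin_spanned K V L \<and> (\<forall>x\<in>carrier V. \<exists>z\<in>carrier V. x \<ominus>\<^bsub>V\<^esub> D z \<in> L)"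
proof -
  obtain H where H: "fin_spanned K V H"
    "\<And>x. x \<in> carrier V \<Longrightarrow> (x \<oplus>\<^bsub>V\<^esub> A (A' (B' (B x)))) \<ominus>\<^bsub>V\<^esub> D x \<in> H"
    using complement_product_finite_rank[OF G near] by blast
  let ?P = "\<lambda>x. A (A' x)" and ?Q = "\<lambda>x. B' (B x)"
  let ?E = "B' ` ((\<lambda>u. B (A u)) ` carrier U)"
  have E: "fin_spanned K V ?E" by (intro B'.fin_spanned_image BA)
  have QP: "?Q (?P x) \<in> ?E" if "x \<in> carrier V" for x using that by blast
  have Qs: "fin_spanned K V (?Q ` S)" if "fin_spanned K V S" for S
    using B'.fin_spanned_image[OF B.fin_spanned_image[OF that]] by (simp add: image_image)
  have Ps: "fin_spanned K V (?P ` S)" if "fin_spanned K V S" for S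
    using A.fin_spanned_image[OF A'.fin_spanned_image[OF that]] by (simp add: image_image)
  let ?neg = "\<lambda>x. \<ominus>\<^bsub>V\<^esub> x"
  let ?Z = "H <+>\<^bsub>V\<^esub> ?neg ` ?P ` (?Q ` H <+>\<^bsub>V\<^esub> ?neg ` ?E)"
  have "fin_spanned K V ?Z"
    by (intro A.W.fin_spanned_add A.W.fin_spanned_uminus Ps Qs H E)
  moreover have "D.ker \<subseteq> ?Z"
  proof
    fix x assume "x \<in> D.ker"
    then have x: "x \<in> carrier V" "D x = \<zero>\<^bsub>V\<^esub>" by (auto simp: D.ker_def)
    \<comment> \<open>Since \<open>D x\<close> vanishes, the bound for
      \<open>x + P Q x - D x\<close> says that \<open>h\<close> itself lies in
      \<open>H\<close>.\<close>
    define h where "h = x \<oplus>\<^bsub>V\<^esub> ?P (?Q x)"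
    have h: "h \<in> H" "h \<in> carrier V"
      using H(2)[OF x(1)] x A.W.module.M.add_eq_imp_eq_minus[of h "\<zero>\<^bsub>V\<^esub>" h]
      by (simp_all add: h_def)
    \<comment> \<open>Applying \<open>Q\<close> to the definition of \<open>h\<close> and using that
      \<open>Q P\<close> has finite rank confines \<open>Q x\<close>; then
      \<open>x = h - P Q x\<close> is confined as well.\<close>
    have "?Q x = ?Q h \<ominus>\<^bsub>V\<^esub> ?Q (?P (?Q x))"
      by (rule A.W.module.M.add_eq_imp_eq_minus) (use x in \<open>simp_all add: h_def\<close>)
    also have "\<dots> \<in> ?Q ` H <+>\<^bsub>V\<^esub> ?neg ` ?E"
      unfolding A.W.module.M.minus_eq by (intro set_addI imageI[of _ _ ?neg] imageI[of h] h QP) (use x in simp)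
    finally have Qx: "?Q x \<in> ?Q ` H <+>\<^bsub>V\<^esub> ?neg ` ?E" .
    have "x = h \<ominus>\<^bsub>V\<^esub> ?P (?Q x)"
      by (rule A.W.module.M.add_eq_imp_eq_minus) (use x in \<open>simp_all add: h_def\<close>)
    also have "\<dots> \<in> ?Z"
      unfolding A.W.module.M.minus_eq by (intro set_addI imageI[of _ _ ?neg] imageI[of "?Q x"] h Qx)
    finally show "x \<in> ?Z" .
  qed
  ultimately show "fin_spanned K V D.ker" by (rule fin_spanned_subset)
  let ?L = "H <+>\<^bsub>V\<^esub> ?P ` ?E"
  have "fin_spanned K V ?L"
    by (intro A.W.fin_spanned_add Ps H E)
  moreover have "\<exists>z\<in>carrier V. x \<ominus>\<^bsub>V\<^esub> D z \<in> ?L" if x: "x \<in> carrier V" for x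
  proof
    define w where "w = ?Q x"
    \<comment> \<open>The approximate preimage is \<open>z = (1 - P Q) x\<close>. Then
      \<open>z + P Q z = x - P Q P Q x\<close>, whose last term accounts for the second summand of
      \<open>?L\<close>; replacing \<open>z + P Q z\<close> by \<open>D z\<close> accounts for
      \<open>H\<close>.\<close>
    define z where "z = x \<ominus>\<^bsub>V\<^esub> ?P w"
    have w: "w \<in> carrier V" using x by (simp add: w_def)
    show z: "z \<in> carrier V" using x w by (simp add: z_def)
    have Qz: "?Q z = w \<ominus>\<^bsub>V\<^esub> ?Q (?P w)" using x w by (simp add: z_def w_def[symmetric])
    have "z \<oplus>\<^bsub>V\<^esub> ?P (?Q z) = x \<ominus>\<^bsub>V\<^esub> ?P (?Q (?P w))"
    proof -
      have "z \<oplus>\<^bsub>V\<^esub> ?P (?Q z) = x \<oplus>\<^bsub>V\<^esub> (\<ominus>\<^bsub>V\<^esub> ?P w \<oplus>\<^bsub>V\<^esub> ?P w) \<oplus>\<^bsub>V\<^esub> \<ominus>\<^bsub>V\<^esub> ?P (?Q (?P w))"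
        unfolding Qz using x w by (simp add: z_def A.W.module.M.minus_eq A.W.module.M.a_assoc)
      then show ?thesis using x w by (simp add: A.W.module.M.l_neg A.W.module.M.minus_eq)
    qed
    then have "(x \<ominus>\<^bsub>V\<^esub> ?P (?Q (?P w))) \<ominus>\<^bsub>V\<^esub> D z \<in> H" (is "?h \<in> H")
      using H(2)[OF z] by simp
    moreover have "x \<ominus>\<^bsub>V\<^esub> D z = ?h \<oplus>\<^bsub>V\<^esub> ?P (?Q (?P w))"
      by (rule A.W.module.M.minus_add_cancel_mid[symmetric]) (use x w z in auto)
    ultimately have "x \<ominus>\<^bsub>V\<^esub> D z = ?h \<oplus>\<^bsub>V\<^esub> ?P (?Q (?P w))" "?h \<in> H" by auto
    moreover have "?h \<oplus>\<^bsub>V\<^esub> ?P (?Q (?P w)) \<in> ?L"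
      by (rule set_addI[OF \<open>?h \<in> H\<close> imageI[OF QP[OF w]]])
    ultimately show "x \<ominus>\<^bsub>V\<^esub> D z \<in> ?L" by simp
  qed
  ultimately show "\<exists>L. fin_spanned K V L \<and> (\<forall>x\<in>carrier V. \<exists>z\<in>carrier V. x \<ominus>\<^bsub>V\<^esub> D z \<in> L)"
    by blast
qed

end

section \<open>Bounded operators and direct sums\<close>

text \<open>On a zero space the constant in \<open>bounded_ops\<close> may be negative. A
  nonnegative one is needed to multiply inequalities by it.\<close>

lemma bounded_ops_obtain_bound:
  assumes "A \<in> bounded_ops X Y" "normed_space X"
  obtains C where "0 \<le> C" "\<And>x. x \<in> carrier X \<Longrightarrow> vnorm Y (A x) \<le> C * vnorm X x"
proof -
  obtain C where C: "\<forall>x\<in>carrier X. vnorm Y (A x) \<le> C * vnorm X x"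
    using assms(1) by (auto simp: bounded_ops_def)
  have "vnorm Y (A x) \<le> max 0 C * vnorm X x" if x: "x \<in> carrier X" for x
  proof -
    have "C * vnorm X x \<le> max 0 C * vnorm X x"
      using assms(2) x by (intro mult_right_mono) (auto simp: normed_space_def)
    then show ?thesis using C x by force
  qed
  then show thesis using that[of "max 0 C"] by simp
qed

lemma bounded_ops_comp:
  assumes "A \<in> bounded_ops X Y" "B \<in> bounded_ops Y Z" "normed_space Y"
  shows "(\<lambda>x. B (A x)) \<in> bounded_ops X Z"
proof -
  obtain C where C: "\<forall>x\<in>carrier X. vnorm Y (A x) \<le> C * vnorm X x"
    using assms(1) by (auto simp: bounded_ops_def)
  obtain E where E: "0 \<le> E" "\<And>y. y \<in> carrier Y \<Longrightarrow> vnorm Z (B y) \<le> E * vnorm Y y"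
    using bounded_ops_obtain_bound[OF assms(2,3)] by blast
  have A: "A x \<in> carrier Y" if "x \<in> carrier X" for x
    using assms(1) that by (auto simp: bounded_ops_def module_hom_def)
  have "(\<lambda>x. B (A x)) \<in> module_hom class_ring X Z"
    using assms(1,2) unfolding bounded_ops_def module_hom_def by (auto simp: Pi_iff)
  moreover have "vnorm Z (B (A x)) \<le> (E * C) * vnorm X x" if x: "x \<in> carrier X" for x
  proof -
    have "vnorm Z (B (A x)) \<le> E * vnorm Y (A x)" using E(2) A x by blast
    also have "\<dots> \<le> E * (C * vnorm X x)" using C x E(1) by (intro mult_left_mono) auto
    finally show ?thesis by (simp add: mult.assoc)
  qed
  ultimately show ?thesis unfolding bounded_ops_def by blast
qed

lemma bounded_ops_add:
  fixes X :: "('k::real_normed_field, 'v) normed" and Y :: "('k, 'w) normed"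
  assumes A: "A \<in> bounded_ops X Y" and B: "B \<in> bounded_ops X Y" and Y: "normed_space Y"
  shows "(\<lambda>x. A x \<oplus>\<^bsub>Y\<^esub> B x) \<in> bounded_ops X Y"
proof -
  interpret Y: vectorspace class_ring Y using Y by (simp add: normed_space_def)
  have hom: "A \<in> module_hom class_ring X Y" "B \<in> module_hom class_ring X Y"
    using A B by (auto simp: bounded_ops_def)
  have closed: "A x \<in> carrier Y" "B x \<in> carrier Y" if "x \<in> carrier X" for x
    using hom that by (auto simp: module_hom_def)
  obtain C E where CE: "\<forall>x\<in>carrier X. vnorm Y (A x) \<le> C * vnorm X x"
      "\<forall>x\<in>carrier X. vnorm Y (B x) \<le> E * vnorm X x"
    using A B by (auto simp: bounded_ops_def)
  have "(\<lambda>x. A x \<oplus>\<^bsub>Y\<^esub> B x) \<in> module_hom class_ring X Y"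
    using module_hom_add[OF hom(1)] module_hom_add[OF hom(2)]
      module_hom_smult[OF hom(1)] module_hom_smult[OF hom(2)] closed
    by (auto simp: module_hom_def Y.a_ac Y.smult_r_distr)
  moreover have "vnorm Y (A x \<oplus>\<^bsub>Y\<^esub> B x) \<le> (C + E) * vnorm X x" if x: "x \<in> carrier X" for x
  proof -
    have "vnorm Y (A x \<oplus>\<^bsub>Y\<^esub> B x) \<le> vnorm Y (A x) + vnorm Y (B x)"
      using Y closed[OF x] by (simp add: normed_space_def)
    also have "\<dots> \<le> C * vnorm X x + E * vnorm X x"
      using CE x by (intro add_mono) auto
    finally show ?thesis by (simp add: distrib_right)
  qed
  ultimately show ?thesis unfolding bounded_ops_def by blast
qed

text \<open>The reindexing \<open>s\<close> covers both shifts, downwards for the operators of the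
  chain and upwards for their generalized inverses. As the components outside the finite set
  \<open>F\<close> vanish, there is a common bound, and injectivity of \<open>s\<close> ensures that
  each component of \<open>f\<close> is counted at most once.\<close>

lemma direct_sum_map_bounded:
  fixes X :: "'i \<Rightarrow> ('k::real_normed_field, 'v) normed" and Y :: "'j \<Rightarrow> ('k, 'w) normed"
  assumes nX: "\<And>i. i \<in> I \<Longrightarrow> normed_space (X i)" and nY: "\<And>j. j \<in> J \<Longrightarrow> normed_space (Y j)"
    and s: "s \<in> J \<rightarrow> I" "inj_on s J"
    and T: "\<And>j. j \<in> J \<Longrightarrow> T j \<in> bounded_ops (X (s j)) (Y j)"
    and F: "finite F" "\<And>j x. j \<in> J \<Longrightarrow> j \<notin> F \<Longrightarrow> x \<in> carrier (X (s j)) \<Longrightarrow> T j x = \<zero>\<^bsub>Y j\<^esub>"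
  shows "(\<lambda>f. \<lambda>j\<in>J. T j (f (s j))) \<in> bounded_ops (direct_sum_space I X) (direct_sum_space J Y)"
    (is "?T \<in> bounded_ops ?X ?Y")
proof -
  have hom: "T j \<in> module_hom class_ring (X (s j)) (Y j)" if "j \<in> J" for j
    using T[OF that] by (simp add: bounded_ops_def)
  have sI: "s j \<in> I" if "j \<in> J" for j using s(1) that by auto
  have T0: "T j \<zero>\<^bsub>X (s j)\<^esub> = \<zero>\<^bsub>Y j\<^esub>" if j: "j \<in> J" for j
  proof -
    interpret linear_map class_ring "X (s j)" "Y j" "T j"
      using nX[OF sI[OF j]] nY[OF j] hom[OF j] by (intro linear_mapI) (auto simp: normed_space_def)
    show ?thesis by simp
  qed
  have X: "f (s j) \<in> carrier (X (s j))" if "f \<in> carrier ?X" "j \<in> J" for f j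
    using that sI by (auto simp: direct_sum_space_def)
  have TX: "T j (f (s j)) \<in> carrier (Y j)" if "f \<in> carrier ?X" "j \<in> J" for f j
    using module_hom_closed[OF hom] X that by blast
  have supp: "{j\<in>J. T j (f (s j)) \<noteq> \<zero>\<^bsub>Y j\<^esub>} \<subseteq> F" if "f \<in> carrier ?X" for f
    using F(2) X[OF that] by blast
  have "?T \<in> carrier ?X \<rightarrow> carrier ?Y"
  proof
    fix f assume f: "f \<in> carrier ?X"
    have "{j\<in>J. ?T f j \<noteq> \<zero>\<^bsub>Y j\<^esub>} = {j\<in>J. T j (f (s j)) \<noteq> \<zero>\<^bsub>Y j\<^esub>}" by auto
    then show "?T f \<in> carrier ?Y"
      using TX[OF f] finite_subset[OF supp[OF f] F(1)] by (simp add: direct_sum_space_def)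
  qed
  moreover have "?T (f \<oplus>\<^bsub>?X\<^esub> g) = ?T f \<oplus>\<^bsub>?Y\<^esub> ?T g" if "f \<in> carrier ?X" "g \<in> carrier ?X" for f g
    using module_hom_add[OF hom] X[OF that(1)] X[OF that(2)] sI
    by (auto simp: direct_sum_space_def fun_eq_iff restrict_def)
  moreover have "?T (c \<odot>\<^bsub>?X\<^esub> f) = c \<odot>\<^bsub>?Y\<^esub> ?T f" if "f \<in> carrier ?X" for f c
    using module_hom_smult[OF hom] X[OF that] sI
    by (auto simp: direct_sum_space_def fun_eq_iff restrict_def)
  ultimately have "?T \<in> module_hom class_ring ?X ?Y"
    unfolding module_hom_def by blast
  moreover have "\<exists>C. \<forall>f\<in>carrier ?X. vnorm ?Y (?T f) \<le> C * vnorm ?X f"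
  proof -
    have "\<exists>C\<ge>0. \<forall>x\<in>carrier (X (s j)). vnorm (Y j) (T j x) \<le> C * vnorm (X (s j)) x" if "j \<in> J" for j
      using bounded_ops_obtain_bound[OF T[OF that] nX[OF sI[OF that]]] by metis
    then obtain C where C: "\<And>j. j \<in> J \<Longrightarrow> 0 \<le> C j" "\<And>j x. j \<in> J \<Longrightarrow> x \<in> carrier (X (s j)) \<Longrightarrow>
        vnorm (Y j) (T j x) \<le> C j * vnorm (X (s j)) x"
      by metis
    \<comment> \<open>A sum rather than a maximum serves as the common bound, since it also makes
      sense if \<open>F\<close> misses \<open>J\<close>.\<close>
    define M where "M = (\<Sum>j\<in>J \<inter> F. C j)"
    have "M \<ge> 0" unfolding M_def using C(1) by (auto intro: sum_nonneg)
    have CM: "C j \<le> M" if "j \<in> J" "j \<in> F" for j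
      unfolding M_def using that F(1) C(1) by (intro member_le_sum) auto
    have "vnorm ?Y (?T f) \<le> M * vnorm ?X f" if f: "f \<in> carrier ?X" for f
    proof -
      let ?S = "{j\<in>J. T j (f (s j)) \<noteq> \<zero>\<^bsub>Y j\<^esub>}" and ?R = "{i\<in>I. f i \<noteq> \<zero>\<^bsub>X i\<^esub>}"
      have fin: "finite ?R" and fI: "\<And>i. i \<in> I \<Longrightarrow> f i \<in> carrier (X i)"
        using f by (auto simp: direct_sum_space_def)
      have nn: "0 \<le> vnorm (X i) (f i)" if "i \<in> I" for i
        using nX[OF that] fI[OF that] by (simp add: normed_space_def)
      have "vnorm ?Y (?T f) = (\<Sum>j\<in>?S. vnorm (Y j) (T j (f (s j))))"
        by (auto simp: direct_sum_space_def intro!: sum.cong)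
      also have "\<dots> \<le> (\<Sum>j\<in>?S. M * vnorm (X (s j)) (f (s j)))"
      proof (rule sum_mono)
        fix j assume j: "j \<in> ?S"
        then have "vnorm (Y j) (T j (f (s j))) \<le> C j * vnorm (X (s j)) (f (s j))"
          using C(2) X[OF f] by blast
        also have "\<dots> \<le> M * vnorm (X (s j)) (f (s j))"
          using CM[of j] supp[OF f] j nn[OF sI] by (intro mult_right_mono) auto
        finally show "vnorm (Y j) (T j (f (s j))) \<le> M * vnorm (X (s j)) (f (s j))" .
      qed
      also have "\<dots> = (\<Sum>i\<in>s ` ?S. M * vnorm (X i) (f i))"
        using s(2) by (subst sum.reindex) (auto intro: inj_on_subset)
      also have "\<dots> \<le> (\<Sum>i\<in>?R. M * vnorm (X i) (f i))"
        using fin nn \<open>M \<ge> 0\<close> T0 sI by (intro sum_mono2) auto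
      also have "\<dots> = M * vnorm ?X f"
        by (simp add: direct_sum_space_def sum_distrib_left)
      finally show ?thesis .
    qed
    then show ?thesis by blast
  qed
  ultimately show ?thesis by (simp add: bounded_ops_def)
qed

text \<open>Chosen generalized inverses of the single operators form a generalized inverse
  componentwise. Leaving \<open>I\<close> and \<open>J\<close> general handles both parities at
  once.\<close>

lemma direct_sum_op_regular:
  assumes X: "banach_sequence n X d"
    and reg: "\<And>p. regular_op (X p) (X (p - 1)) (d p)"
    and IJ: "\<And>q. q \<in> J \<longleftrightarrow> q + 1 \<in> I"
  shows "regular_op (direct_sum_space I X) (direct_sum_space J X) (direct_sum_op J d)"
proof -
  have nX: "normed_space (X p)" for p
    using X by (simp add: banach_sequence_def banach_space_def)
  have zX: "x = \<zero>\<^bsub>X p\<^esub>" if "p < 0 \<or> p \<ge> int n + 1" "x \<in> carrier (X p)" for p x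
    using X that unfolding banach_sequence_def by blast
  have d: "d p \<in> bounded_ops (X p) (X (p - 1))" for p
    using X by (simp add: banach_sequence_def)
  obtain g where "\<And>p. generalized_inverse (X p) (X (p - 1)) (d p) (g p)"
    using reg unfolding regular_op_def by metis
  then have g: "g p \<in> bounded_ops (X (p - 1)) (X p)"
      "\<And>x. x \<in> carrier (X p) \<Longrightarrow> d p (g p (d p x)) = d p x" for p
    by (auto simp: generalized_inverse_def)
  \<comment> \<open>The \<open>g p\<close> are arbitrary choices, but outside
    \<open>{0..int n}\<close> their target space is zero. So only finitely many components of their
    sum are nonzero.\<close>
  have g0: "g p x = \<zero>\<^bsub>X p\<^esub>" if p: "p \<notin> {0..int n}" and x: "x \<in> carrier (X (p - 1))" for p x
  proof (rule zX)
    show "p < 0 \<or> p \<ge> int n + 1" using p by auto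
    show "g p x \<in> carrier (X p)" using g(1)[of p] x by (auto simp: bounded_ops_def module_hom_def)
  qed
  have "(\<lambda>f. \<lambda>q\<in>J. d (q + 1) (f (q + 1))) \<in>
      bounded_ops (direct_sum_space I X) (direct_sum_space J X)"
  \<comment> \<open>The component with index \<open>q\<close> is \<open>d (q + 1)\<close>, so the
    indices are shifted down by one against those of the chain; the set is chosen large enough to
    cover the shift.\<close>
  proof (rule direct_sum_map_bounded[where F = "{-1..int n}"])
    show "d (q + 1) x = \<zero>\<^bsub>X q\<^esub>" if "q \<notin> {-1..int n}" "x \<in> carrier (X (q + 1))" for q x
    proof -
      have "q + 1 \<le> 0 \<or> q + 1 > int n" using that(1) by auto
      then show ?thesis
        using X that(2) unfolding banach_sequence_def by (metis add_diff_cancel_right')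
    qed
    show "d (q + 1) \<in> bounded_ops (X (q + 1)) (X q)" for q using d[of "q + 1"] by simp
  qed (use nX IJ in auto)
  moreover have "(\<lambda>f. \<lambda>p\<in>I. g p (f (p - 1))) \<in>
      bounded_ops (direct_sum_space J X) (direct_sum_space I X)"
    by (rule direct_sum_map_bounded[where F = "{0..int n}"]) (use nX IJ g(1) g0 in auto)
  moreover have "(\<lambda>q\<in>J. d (q + 1) ((\<lambda>p\<in>I. g p ((\<lambda>q\<in>J. d (q + 1) (f (q + 1))) (p - 1))) (q + 1))) =
      (\<lambda>q\<in>J. d (q + 1) (f (q + 1)))" if "f \<in> carrier (direct_sum_space I X)" for f
    using that g(2) IJ by (auto simp: direct_sum_space_def fun_eq_iff restrict_def)
  ultimately show ?thesis
    unfolding regular_op_def generalized_inverse_def direct_sum_op_def by blast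
qed

section \<open>Fredholm chains\<close>

lemma mod_hom_ker_eq_a_kernel:
  "mod_hom K V W T \<Longrightarrow> mod_hom.ker V W T = a_kernel V W T"
  by (simp add: mod_hom.ker_def a_kernel_def')

text \<open>Negation in a record is determined within its carrier and so could change under
  restriction. Scalar multiplication by -1, which does not refer to the carrier, identifies the two
  versions.\<close>

lemma restr_minus:
  fixes V :: "('k::real_normed_field, 'v) normed"
  assumes "VectorSpace.subspace class_ring N V" "x \<in> N" "y \<in> N"
  shows "x \<ominus>\<^bsub>restr V N\<^esub> y = x \<ominus>\<^bsub>V\<^esub> y"
proof -
  interpret V: vectorspace class_ring V using assms(1) by (simp add: VectorSpace.subspace_def)
  interpret N: vectorspace class_ring "restr V N" by (rule V.subspace_is_vs[OF assms(1)])
  have "y \<in> carrier V"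
    using assms by (auto simp: VectorSpace.subspace_def submodule_def)
  then show ?thesis
    using V.smult_minus_1[of y] N.smult_minus_1[of y] assms(3) by (simp add: a_minus_def)
qed

lemma fredholm_op_iff:
  fixes X :: "('k::real_normed_field, 'v) normed" and Y :: "('k, 'w) normed"
  assumes lin: "linear_map class_ring X Y T" and T: "T \<in> bounded_ops X Y"
  shows "fredholm_op X Y T \<longleftrightarrow> fin_spanned class_ring X (mod_hom.ker X Y T) \<and>
    (\<exists>L. fin_spanned class_ring Y L \<and> (\<forall>y\<in>carrier Y. \<exists>x\<in>carrier X. y \<ominus>\<^bsub>Y\<^esub> T x \<in> L))"
proof -
  interpret linear_map class_ring X Y T by fact
  show ?thesis
    unfolding fredholm_op_def mod_hom_ker_eq_a_kernel[OF mod_hom_axioms, symmetric]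
      V.fin_dim_restrict_iff[OF subspace_ker_image(1)]
      findim_quotient_space_iff[OF subspace_ker_image(2)]
    by (simp add: T)
qed

context
  fixes U :: "('k::real_normed_field, 'u) normed" and V :: "('k, 'v) normed" and W :: "('k, 'w) normed"
    and A B
  assumes A: "linear_map class_ring U V A" and B: "linear_map class_ring V W B"
begin

interpretation A: linear_map class_ring U V A by (rule A)
interpretation B: linear_map class_ring V W B by (rule B)

lemma kernel_inter_range:
  "mod_hom.ker (restr V (A ` carrier U)) W B = a_kernel V W B \<inter> A ` carrier U"
proof -
  interpret AB: linear_map class_ring "restr V (A ` carrier U)" W B
    by (rule B.linear_map_restrict[OF A.subspace_ker_image(2)])
  show ?thesis
    unfolding AB.ker_def a_kernel_def' using A.f_im by auto
qed

text \<open>The restriction of \<open>B\<close> to the range of \<open>A\<close> has the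
  intersection as its kernel and the range of \<open>B A\<close> as its range.\<close>

lemma findim_range_quotient:
  assumes "fin_spanned class_ring W ((\<lambda>u. B (A u)) ` carrier U)"
  shows "findim (quotient_space (restr V (A ` carrier U)) (a_kernel V W B \<inter> A ` carrier U))"
  using findim_quotient_ker[OF B.linear_map_restrict[OF A.subspace_ker_image(2)]] assms
  by (simp add: kernel_inter_range image_image)

text \<open>The set \<open>G\<close> need not lie in the kernel \<open>N\<close> of
  \<open>B\<close>. For the converse \<open>N\<close> is therefore mapped to the quotient of
  \<open>V\<close> by the range \<open>R\<close> of \<open>A\<close>: the kernel of this map is the
  intersection of \<open>N\<close> and \<open>R\<close>, and its image consists of cosets of
  elements of \<open>G\<close>.\<close>

lemma findim_kernel_quotient_iff:
  "findim (quotient_space (restr V (a_kernel V W B)) (a_kernel V W B \<inter> A ` carrier U)) \<longleftrightarrow>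
     (\<exists>G. fin_spanned class_ring V G \<and>
       (\<forall>x\<in>carrier V. B x = \<zero>\<^bsub>W\<^esub> \<longrightarrow> (\<exists>u\<in>carrier U. x \<ominus>\<^bsub>V\<^esub> A u \<in> G)))"
proof -
  define N where "N = a_kernel V W B"
  define R where "R = A ` carrier U"
  have N_iff: "x \<in> N \<longleftrightarrow> x \<in> carrier V \<and> B x = \<zero>\<^bsub>W\<^esub>" for x
    by (auto simp: N_def a_kernel_def')
  have N: "VectorSpace.subspace class_ring N V"
    using B.subspace_ker_image(1) by (simp add: N_def mod_hom_ker_eq_a_kernel[OF B.mod_hom_axioms])
  have R: "VectorSpace.subspace class_ring R V"
    using A.subspace_ker_image(2) by (simp add: R_def)
  interpret c: linear_map class_ring V "quotient_space V R" "coset_map V R"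
    by (rule linear_map_coset_map[OF R])
  interpret cN: linear_map class_ring "restr V N" "quotient_space V R" "coset_map V R"
    by (rule c.linear_map_restrict[OF N])
  have ker: "cN.ker = N \<inter> R"
    using coset_map_eq_zero_iff[OF R] N_iff by (auto simp: cN.ker_def)
  show ?thesis
    unfolding N_def[symmetric] R_def[symmetric]
  proof
    assume "findim (quotient_space (restr V N) (N \<inter> R))"
    then obtain G where G: "fin_spanned class_ring (restr V N) G"
        "\<forall>x\<in>N. \<exists>w\<in>N \<inter> R. x \<ominus>\<^bsub>restr V N\<^esub> w \<in> G"
      using findim_quotient_space_iff[OF cN.subspace_ker_image(1)] unfolding ker by auto
    have "fin_spanned class_ring V G"
      by (rule A.W.fin_spanned_restrictD[OF N G(1)])
    moreover have "\<exists>u\<in>carrier U. x \<ominus>\<^bsub>V\<^esub> A u \<in> G" if "x \<in> carrier V" "B x = \<zero>\<^bsub>W\<^esub>" for x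
    proof -
      have x: "x \<in> N" using that N_iff by blast
      then obtain w where w: "w \<in> N" "w \<in> R" "x \<ominus>\<^bsub>restr V N\<^esub> w \<in> G" using G(2) by blast
      then show ?thesis using restr_minus[OF N x w(1)] by (auto simp: R_def)
    qed
    ultimately show "\<exists>G. fin_spanned class_ring V G \<and>
        (\<forall>x\<in>carrier V. B x = \<zero>\<^bsub>W\<^esub> \<longrightarrow> (\<exists>u\<in>carrier U. x \<ominus>\<^bsub>V\<^esub> A u \<in> G))" by blast
  next
    assume "\<exists>G. fin_spanned class_ring V G \<and>
        (\<forall>x\<in>carrier V. B x = \<zero>\<^bsub>W\<^esub> \<longrightarrow> (\<exists>u\<in>carrier U. x \<ominus>\<^bsub>V\<^esub> A u \<in> G))"
    then obtain G where G: "fin_spanned class_ring V G"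
        "\<And>x. x \<in> N \<Longrightarrow> \<exists>u\<in>carrier U. x \<ominus>\<^bsub>V\<^esub> A u \<in> G"
      using N_iff by blast
    have "coset_map V R ` N \<subseteq> coset_map V R ` G"
    proof
      fix y assume "y \<in> coset_map V R ` N"
      then obtain x where x: "x \<in> N" "y = coset_map V R x" by blast
      then obtain u where u: "u \<in> carrier U" "x \<ominus>\<^bsub>V\<^esub> A u \<in> G" using G(2) by blast
      have xV: "x \<in> carrier V" using x N_iff by blast
      have "A u = x \<ominus>\<^bsub>V\<^esub> (x \<ominus>\<^bsub>V\<^esub> A u)"
        using xV u by (simp add: a_minus_def A.W.module.M.minus_add A.W.module.M.r_neg1 A.W.module.M.r_neg2)
      then have "y = coset_map V R (x \<ominus>\<^bsub>V\<^esub> A u)"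
        using xV u x(2) coset_map_eq_iff[OF R xV, of "x \<ominus>\<^bsub>V\<^esub> A u"] by (auto simp: R_def)
      then show "y \<in> coset_map V R ` G" using u by blast
    qed
    then have "fin_spanned class_ring (quotient_space V R) (coset_map V R ` carrier (restr V N))"
      using c.fin_spanned_image[OF G(1)] fin_spanned_subset by auto
    then show "findim (quotient_space (restr V N) (N \<inter> R))"
      using findim_quotient_ker[OF cN.linear_map_axioms] by (simp add: ker)
  qed
qed

end

section \<open>Extensions of generalized inverses from the quotients\<close>

lemma complement_representative:
  fixes Z :: "('k::real_normed_field, 'z) normed"
  assumes "VectorSpace.subspace class_ring F Z" "Z0 \<subseteq> carrier Z" "F <+>\<^bsub>Z\<^esub> Z0 = carrier Z"
    and "z \<in> carrier Z"
  obtains f z0 where "f \<in> F" "z0 \<in> Z0" "z = f \<oplus>\<^bsub>Z\<^esub> z0" "coset_map Z F z = coset_map Z F z0"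
proof -
  have "z \<in> F <+>\<^bsub>Z\<^esub> Z0" using assms by simp
  then obtain f z0 where "f \<in> F" "z0 \<in> Z0" "z = f \<oplus>\<^bsub>Z\<^esub> z0"
    unfolding set_add_def' by blast
  moreover from this have "coset_map Z F z = coset_map Z F z0"
    using coset_map_add_subspace[OF assms(1)] assms(2) by blast
  ultimately show thesis by (rule that)
qed

text \<open>Write \<open>A x = f + y\<close> with \<open>f\<close> in \<open>FY\<close> and
  \<open>y\<close> in \<open>Y0\<close>. On \<open>y\<close> the extension represents
  \<open>B\<close>, so \<open>A (A' y)\<close> agrees with \<open>A x\<close> modulo
  \<open>FY\<close>; the rest, \<open>A (A' f)\<close>, runs through the image of the finite
  dimensional \<open>FY\<close>.\<close>

lemma quotient_generalized_inverse_finite_rank: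
  fixes X :: "('k::real_normed_field, 'v) normed" and Y :: "('k, 'w) normed"
  assumes A: "linear_map class_ring X Y A" and A': "linear_map class_ring Y X A'"
    and FX: "VectorSpace.subspace class_ring FX X" and FY: "VectorSpace.subspace class_ring FY Y"
    and AF: "A ` FX \<subseteq> FY" and fin: "fin_spanned class_ring Y FY"
    and X0: "X0 \<subseteq> carrier X" "FX <+>\<^bsub>X\<^esub> X0 = carrier X"
    and Y0: "Y0 \<subseteq> carrier Y" "FY <+>\<^bsub>Y\<^esub> Y0 = carrier Y"
    and B: "generalized_inverse (quotient_space X FX) (quotient_space Y FY) (induced_op Y FY A) B"
    and ext: "\<And>y. y \<in> Y0 \<Longrightarrow> A' y = inv_into X0 (coset_map X FX) (B (coset_map Y FY y))"
  shows "fin_spanned class_ring Y ((\<lambda>x. A x \<ominus>\<^bsub>Y\<^esub> A (A' (A x))) ` carrier X)"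
proof -
  interpret A: linear_map class_ring X Y A by fact
  interpret A': linear_map class_ring Y X A' by fact
  interpret pX: linear_map class_ring X "quotient_space X FX" "coset_map X FX"
    by (rule linear_map_coset_map[OF FX])
  interpret pY: linear_map class_ring Y "quotient_space Y FY" "coset_map Y FY"
    by (rule linear_map_coset_map[OF FY])
  let ?pX = "coset_map X FX" and ?pY = "coset_map Y FY" and ?q = "induced_op Y FY A"
  have q: "?q (?pX x) = ?pY (A x)" if "x \<in> carrier X" for x
    by (rule induced_op_coset_map[OF FX FY A.f_hom AF that])
  have B_hom: "B \<in> module_hom class_ring (quotient_space Y FY) (quotient_space X FX)"
    and B_inv: "\<And>x. x \<in> carrier (quotient_space X FX) \<Longrightarrow> ?q (B (?q x)) = ?q x"
    using B by (auto simp: generalized_inverse_def bounded_ops_def)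
  \<comment> \<open>Since \<open>X0\<close> and \<open>FX\<close> span \<open>X\<close>, every coset
    has a representative in \<open>X0\<close>, so \<open>inv_into\<close> returns a true
    preimage.\<close>
  have pA': "?pX (A' y) = B (?pY y)" if y: "y \<in> Y0" for y
  proof -
    have "B (?pY y) \<in> carrier (quotient_space X FX)"
      using module_hom_closed[OF B_hom] y Y0(1) by auto
    then obtain x where x: "x \<in> carrier X" "B (?pY y) = ?pX x"
      using coset_map_surj[OF FX] by blast
    obtain f x0 where "x0 \<in> X0" "?pX x = ?pX x0"
      using complement_representative[OF FX X0 x(1)] .
    then have "B (?pY y) \<in> ?pX ` X0" using x(2) by simp
    then show ?thesis unfolding ext[OF y] by (rule f_inv_into_f)
  qed
  let ?S = "FY <+>\<^bsub>Y\<^esub> (\<lambda>y. \<ominus>\<^bsub>Y\<^esub> y) ` A ` A' ` FY"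
  have "fin_spanned class_ring Y ?S"
    by (intro A.W.fin_spanned_add A.W.fin_spanned_uminus A.fin_spanned_image A'.fin_spanned_image fin)
  moreover have "A x \<ominus>\<^bsub>Y\<^esub> A (A' (A x)) \<in> ?S" if x: "x \<in> carrier X" for x
  proof -
    have "A x \<in> carrier Y" using x by simp
    from complement_representative[OF FY Y0 this] obtain f y where
      fy: "f \<in> FY" "y \<in> Y0" "A x = f \<oplus>\<^bsub>Y\<^esub> y" "?pY (A x) = ?pY y" .
    have fY: "f \<in> carrier Y" using A.W.fin_spanned_closed[OF fin fy(1)] .
    have yY: "y \<in> carrier Y" using fy Y0 by blast
    have "?pY (A (A' y)) = ?q (B (?pY y))"
      using q[of "A' y"] pA'[OF fy(2)] yY by simp
    also have "\<dots> = ?q (B (?q (?pX x)))" using q[OF x] fy(4) by simp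
    also have "\<dots> = ?pY (A x)" using B_inv[of "?pX x"] q[OF x] x by simp
    finally have "A x \<ominus>\<^bsub>Y\<^esub> A (A' y) \<in> FY"
      using coset_map_eq_iff[OF FY, of "A x" "A (A' y)"] x yY by simp
    moreover have "A x \<ominus>\<^bsub>Y\<^esub> A (A' (A x)) = (A x \<ominus>\<^bsub>Y\<^esub> A (A' y)) \<oplus>\<^bsub>Y\<^esub> \<ominus>\<^bsub>Y\<^esub> A (A' f)"
    proof -
      have "A (A' (A x)) = A (A' f) \<oplus>\<^bsub>Y\<^esub> A (A' y)"
        unfolding fy(3) using fY yY by simp
      then show ?thesis
        using x fY yY
        by (simp add: a_minus_def A.W.module.M.minus_add A.W.module.M.a_assoc
            A.W.module.M.a_comm[of "\<ominus>\<^bsub>Y\<^esub> A (A' f)" "\<ominus>\<^bsub>Y\<^esub> A (A' y)"])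
    qed
    ultimately show ?thesis
      using fy(1) by (auto intro!: set_addI)
  qed
  ultimately show ?thesis by (blast intro: fin_spanned_subset)
qed

theorem theorem4p4:
  fixes n :: nat
    and X :: "int \<Rightarrow> ('k::real_normed_field, 'v) normed"
    and d :: "int \<Rightarrow> 'v \<Rightarrow> 'v"
    and X0 :: "int \<Rightarrow> 'v set"
    and dt' :: "int \<Rightarrow> 'v set \<Rightarrow> 'v set"
    and d' :: "int \<Rightarrow> 'v \<Rightarrow> 'v"
  assumes "banach_sequence n X d"
    and "\<And>p. findim (restr (X (p - 2)) (comp_range X d p))"
    and "\<And>p. regular_op (X p) (X (p - 1)) (d p)"
    and "\<And>p. generalized_inverse (quot_chain X d p) (quot_chain X d (p - 1)) (quot_op X d p) (dt' p)"
    and "closed_complements X d X0"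
    and "\<And>p. is_extension X d X0 p (dt' p) (d' p)"
  shows "regular_fredholm_chain X d \<longleftrightarrow>
    (\<forall>p. fredholm_op (X p) (X p) (\<lambda>x. d (p + 1) (d' (p + 1) x) \<oplus>\<^bsub>X p\<^esub> d' p (d p x)))"
proof -
  have normed: "normed_space (X p)" for p
    using assms(1) by (simp add: banach_sequence_def banach_space_def)
  have vs: "vectorspace class_ring (X p)" for p
    using normed by (simp add: normed_space_def)
  have bd: "d p \<in> bounded_ops (X p) (X (p - 1))" for p
    using assms(1) by (simp add: banach_sequence_def)
  have bd': "d' p \<in> bounded_ops (X (p - 1)) (X p)" for p
    using assms(6) by (simp add: is_extension_def)
  have d: "linear_map class_ring (X p) (X (p - 1)) (d p)" for p
    using bd by (intro linear_mapI vs) (simp add: bounded_ops_def)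
  have d': "linear_map class_ring (X (p - 1)) (X p) (d' p)" for p
    using bd' by (intro linear_mapI vs) (simp add: bounded_ops_def)
  have d1: "linear_map class_ring (X (p + 1)) (X p) (d (p + 1))" for p
    using d[of "p + 1"] by simp
  have d1': "linear_map class_ring (X p) (X (p + 1)) (d' (p + 1))" for p
    using d'[of "p + 1"] by simp
  have range: "comp_range X d (p + 2) = (\<lambda>x. d (p + 1) (d (p + 2) x)) ` carrier (X (p + 2))" for p
    by (simp add: comp_range_def algebra_simps)
  have sub: "VectorSpace.subspace class_ring (comp_range X d (p + 2)) (X p)" for p
  proof -
    have "linear_map class_ring (X (p + 2)) (X (p + 1)) (d (p + 2))"
      using d1[of "p + 1"] by (simp add: algebra_simps)
    from linear_map.subspace_ker_image(2)[OF linear_map_comp[OF this d1[of p]]]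
    show ?thesis by (simp add: range)
  qed
  have fin: "fin_spanned class_ring (X p) (comp_range X d (p + 2))" for p
    using assms(2)[of "p + 2"] vectorspace.fin_dim_restrict_iff[OF vs sub] by simp
  have X0: "X0 p \<subseteq> carrier (X p)" "comp_range X d (p + 2) <+>\<^bsub>X p\<^esub> X0 p = carrier (X p)" for p
    using assms(5)
    by (simp_all add: closed_complements_def closed_subspace_def VectorSpace.subspace_def submodule_def)
  have inv: "fin_spanned class_ring (X (p - 1))
      ((\<lambda>x. d p x \<ominus>\<^bsub>X (p - 1)\<^esub> d p (d' p (d p x))) ` carrier (X p))" for p
  proof (rule quotient_generalized_inverse_finite_rank[OF d d' sub sub _ fin X0 X0])
    \<comment> \<open>Three consecutive operators are regrouped, so that the first two applied to
      \<open>d (p + 2) x\<close> appear. This inclusion makes the induced operator well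
      defined.\<close>
    show "d p ` comp_range X d (p + 2) \<subseteq> comp_range X d (p - 1 + 2)"
    proof
      fix y assume "y \<in> d p ` comp_range X d (p + 2)"
      then obtain x where x: "x \<in> carrier (X (p + 2))" "y = d p (d (p + 1) (d (p + 2) x))"
        by (auto simp: range)
      have "d (p + 2) x \<in> carrier (X (p + 1))"
        using bd[of "p + 2"] x(1) by (auto simp: bounded_ops_def module_hom_def algebra_simps)
      with x(2) show "y \<in> comp_range X d (p - 1 + 2)"
        by (auto simp: comp_range_def algebra_simps)
    qed
    show "generalized_inverse (quotient_space (X p) (comp_range X d (p + 2)))
        (quotient_space (X (p - 1)) (comp_range X d (p - 1 + 2)))
        (induced_op (X (p - 1)) (comp_range X d (p - 1 + 2)) (d p)) (dt' p)"
      using assms(4)[of p] by (simp only: quot_chain_def quot_op_def)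
    show "d' p y = inv_into (X0 p) (coset_map (X p) (comp_range X d (p + 2)))
        (dt' p (coset_map (X (p - 1)) (comp_range X d (p - 1 + 2)) y))" if "y \<in> X0 (p - 1)" for y
      using assms(6)[of p] that unfolding is_extension_def quot_proj_def by blast
  qed
  have pair: "regular_pair class_ring (X (p + 1)) (X p) (X (p - 1)) (d (p + 1)) (d' (p + 1)) (d p) (d' p)" for p
  proof (intro regular_pair.intro regular_pair_axioms.intro d d' d1 d1')
    show "fin_spanned class_ring (X p)
        ((\<lambda>u. d (p + 1) u \<ominus>\<^bsub>X p\<^esub> d (p + 1) (d' (p + 1) (d (p + 1) u))) ` carrier (X (p + 1)))"
      using inv[of "p + 1"] by simp
    show "fin_spanned class_ring (X (p - 1)) ((\<lambda>u. d p (d (p + 1) u)) ` carrier (X (p + 1)))"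
      using fin[of "p - 1"] by (simp add: comp_range_def algebra_simps)
  qed (rule inv)
  \<comment> \<open>Both sides of the equivalence are reduced, separately at each \<open>p\<close>,
    to this condition: up to a finite dimensional space, the kernel of \<open>d p\<close> lies in
    the range of \<open>d (p + 1)\<close>.\<close>
  define near where "near p \<longleftrightarrow> (\<exists>G. fin_spanned class_ring (X p) G \<and>
      (\<forall>x\<in>carrier (X p). d p x = \<zero>\<^bsub>X (p - 1)\<^esub> \<longrightarrow>
        (\<exists>u\<in>carrier (X (p + 1)). x \<ominus>\<^bsub>X p\<^esub> d (p + 1) u \<in> G)))" for p
  have "fredholm_op (X p) (X p) (\<lambda>x. d (p + 1) (d' (p + 1) x) \<oplus>\<^bsub>X p\<^esub> d' p (d p x)) \<longleftrightarrow> near p" for p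
  proof -
    interpret P: regular_pair class_ring "X (p + 1)" "X p" "X (p - 1)" "d (p + 1)" "d' (p + 1)" "d p" "d' p"
      by (rule pair)
    have D: "P.D = (\<lambda>x. d (p + 1) (d' (p + 1) x) \<oplus>\<^bsub>X p\<^esub> d' p (d p x))"
      by (simp add: P.D_def fun_eq_iff)
    have "P.D \<in> bounded_ops (X p) (X p)"
      unfolding D using bd[of "p + 1"] bd'[of "p + 1"]
      by (intro bounded_ops_add bounded_ops_comp[OF _ bd[of "p + 1", simplified]] bounded_ops_comp[OF bd bd'] normed)
        auto
    note iff = fredholm_op_iff[OF P.D_linear this]
    have "fredholm_op (X p) (X p) P.D \<longleftrightarrow> near p"
    proof
      assume "fredholm_op (X p) (X p) P.D"
      then have "fin_spanned class_ring (X p) P.D.ker" by (simp only: iff)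
      then show "near p" by (rule P.kernel_near_range) (auto simp: near_def)
    next
      assume "near p"
      then obtain G where "fin_spanned class_ring (X p) G"
        "\<And>x. x \<in> carrier (X p) \<Longrightarrow> d p x = \<zero>\<^bsub>X (p - 1)\<^esub> \<Longrightarrow>
          \<exists>u\<in>carrier (X (p + 1)). x \<ominus>\<^bsub>X p\<^esub> d (p + 1) u \<in> G"
        unfolding near_def by blast
      from P.fredholm_if_kernel_near_range[OF this] show "fredholm_op (X p) (X p) P.D"
        unfolding iff by (rule conjI)
    qed
    then show ?thesis by (simp only: D)
  qed
  moreover have "regular_fredholm_chain X d \<longleftrightarrow> (\<forall>p. near p)"
  proof -
    have "findim (quotient_space (restr (X p) (d (p + 1) ` carrier (X (p + 1))))
        (a_kernel (X p) (X (p - 1)) (d p) \<inter> d (p + 1) ` carrier (X (p + 1))))" for p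
      by (rule findim_range_quotient[OF d1 d regular_pair.BA[OF pair]])
    moreover have "findim (quotient_space (restr (X p) (a_kernel (X p) (X (p - 1)) (d p)))
        (a_kernel (X p) (X (p - 1)) (d p) \<inter> d (p + 1) ` carrier (X (p + 1)))) \<longleftrightarrow> near p" for p
      unfolding near_def by (rule findim_kernel_quotient_iff[OF d1 d])
    moreover have "regular_op (direct_sum_space {p. even p} X) (direct_sum_space {p. odd p} X)
          (direct_sum_op {p. odd p} d)"
        "regular_op (direct_sum_space {p. odd p} X) (direct_sum_space {p. even p} X)
          (direct_sum_op {p. even p} d)"
      by (auto intro!: direct_sum_op_regular[OF assms(1,3)])
    ultimately show ?thesis
      unfolding regular_fredholm_chain_def fredholm_chain_def Let_def using assms(1) by blast
  qed
  ultimately show ?thesis by simp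
qed

end
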